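(* Assume $C=I_{n_x}$ (full-state measurement, so $n_y=n_x$). Then for every $\nu>J^\star$ there exists a constant $\mu>0$ such that $$\mu\left(J(K)-J^\star\right)\le \operatorname{dist}(0,\partial J(K)),\qquad \forall K\in\mathcal{K}_\nu,$$ where $\mathcal{K}_\nu:=\{K\in\mathcal{K}\mid J(K)\le\nu\}$, $\partial J$ denotes the Fréchet subdifferential of $J$, and $J^\star=\min_{K\in\mathcal{K}}J(K)$.
   Context: Fix $A\in\mathbb{R}^{n_x\times n_x}$, $B\in\mathbb{R}^{n_x\times n_u}$, $B_w\in\mathbb{R}^{n_x\times n_w}$, $C\in\mathbb{R}^{n_y\times n_x}$ and symmetric matrices $Q\in\mathbb{R}^{n_x\times n_x}$, $R\in\mathbb{R}^{n_u\times n_u}$. Standing assumptions: $(A,B)$ is stabilizable; $B_w$ and $C$ have full row rank; $Q$ and $R$ are positive definite; and the set of stabilizing gains $$\mathcal{K}:=\{K\in\mathbb{R}^{n_u\times n_y}\mid \text{all eigenvalues of } A+BKC \text{ have modulus}<1\}$$ is nonempty. For $K\in\mathcal{K}$ and $\omega\in[0,2\pi]$ let $$\mathbf{T}_{zw}(K,\omega)=\begin{bmatrix}Q^{1/2}\\ R^{1/2}KC\end{bmatrix}\left(e^{j\omega}I-(A+BKC)\right)^{-1}B_w,$$ where $j$ is the imaginary unit. The $\mathcal{H}_\infty$ cost is $J(K):=\max_{\omega\in[0,2\pi]}\sigma_{\max}(\mathbf{T}_{zw}(K,\omega))$ for $K\in\mathcal{K}$, where $\sigma_{\max}$ is the largest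 singular value. The Fréchet subdifferential of a locally Lipschitz function $f$ on an open set at $\bar x$ is $$\partial f(\bar x)=\left\{v\;\middle|\;\liminf_{y\to\bar x,\,y\ne\bar x}\frac{f(y)-f(\bar x)-\langle v,y-\bar x\rangle}{\|y-\bar x\|}\ge 0\right\}.$$ On matrix spaces, $\langle\cdot,\cdot\rangle$ is the trace inner product, the norm is the Frobenius norm, and $\operatorname{dist}$ is the distance in that norm. *)

theory Defs
  imports "HOL-Analysis.Analysis"
begin

section \<open>Matrices\<close>

definition complex_matrix :: "real^'n^'m \<Rightarrow> complex^'n^'m" where
  "complex_matrix M = (\<chi> i j. complex_of_real (M $ i $ j))"

definition conj_transpose :: "complex^'n^'m \<Rightarrow> complex^'m^'n" where
  "conj_transpose M = (\<chi> i j. cnj (M $ j $ i))"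

definition mat_eigenvalue :: "complex^'n^'n \<Rightarrow> complex \<Rightarrow> bool" where
  "mat_eigenvalue M l \<longleftrightarrow> (\<exists>v. v \<noteq> 0 \<and> M *v v = l *s v)"

definition singular_values :: "complex^'n^'m \<Rightarrow> real set" where
  "singular_values M =
     {s. 0 \<le> s \<and> mat_eigenvalue (conj_transpose M ** M) (complex_of_real (s\<^sup>2))}"

definition sigma_max :: "complex^'n^'m \<Rightarrow> real" where
  "sigma_max M = Max (singular_values M)"

definition symmetric_mat :: "real^'n^'n \<Rightarrow> bool" where
  "symmetric_mat M \<longleftrightarrow> transpose M = M"

definition pos_semidef :: "real^'n^'n \<Rightarrow> bool" where
  "pos_semidef M \<longleftrightarrow> symmetric_mat M \<and> (\<forall>x. 0 \<le> x \<bullet> (M *v x))"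

definition pos_def :: "real^'n^'n \<Rightarrow> bool" where
  "pos_def M \<longleftrightarrow> symmetric_mat M \<and> (\<forall>x. x \<noteq> 0 \<longrightarrow> 0 < x \<bullet> (M *v x))"

text \<open>The principal square root, well defined for positive semidefinite arguments.\<close>

definition psd_sqrt :: "real^'n^'n \<Rightarrow> real^'n^'n" where
  "psd_sqrt M = (THE S. pos_semidef S \<and> S ** S = M)"

definition full_row_rank :: "real^'n^'m \<Rightarrow> bool" where
  "full_row_rank M \<longleftrightarrow> rank M = CARD('m)"

definition stack_rows :: "'a^'n^'m \<Rightarrow> 'a^'n^'k \<Rightarrow> 'a^'n^('m + 'k)" where
  "stack_rows M N = (\<chi> i. case i of Inl a \<Rightarrow> M $ a | Inr b \<Rightarrow> N $ b)"

section \<open>Static output feedback\<close>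

definition schur_stable :: "real^'n^'n \<Rightarrow> bool" where
  "schur_stable M \<longleftrightarrow> (\<forall>l. mat_eigenvalue (complex_matrix M) l \<longrightarrow> cmod l < 1)"

definition stabilizable :: "real^'x^'x \<Rightarrow> real^'u^'x \<Rightarrow> bool" where
  "stabilizable A B \<longleftrightarrow> (\<exists>F :: real^'x^'u. schur_stable (A + B ** F))"

definition stabilizing_gains ::
    "real^'x^'x \<Rightarrow> real^'u^'x \<Rightarrow> real^'x^'y \<Rightarrow> (real^'y^'u) set" where
  "stabilizing_gains A B C = {K. schur_stable (A + B ** K ** C)}"

definition T_zw ::
    "real^'x^'x \<Rightarrow> real^'u^'x \<Rightarrow> real^'w^'x \<Rightarrow> real^'x^'y \<Rightarrow> real^'x^'x \<Rightarrow> real^'u^'u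
      \<Rightarrow> real^'y^'u \<Rightarrow> real \<Rightarrow> complex^'w^('x + 'u)" where
  "T_zw A B Bw C Q R K \<omega> =
     complex_matrix (stack_rows (psd_sqrt Q) (psd_sqrt R ** K ** C))
       ** matrix_inv (mat (exp (\<i> * complex_of_real \<omega>)) - complex_matrix (A + B ** K ** C))
       ** complex_matrix Bw"

text \<open>For a stabilizing gain the function of \<open>\<omega>\<close> is continuous on a compact interval, so the
  supremum below is a maximum; for other gains the value is irrelevant.\<close>

definition hinf_cost ::
    "real^'x^'x \<Rightarrow> real^'u^'x \<Rightarrow> real^'w^'x \<Rightarrow> real^'x^'y \<Rightarrow> real^'x^'x \<Rightarrow> real^'u^'u
      \<Rightarrow> real^'y^'u \<Rightarrow> real" where
  "hinf_cost A B Bw C Q R K = (SUP \<omega>\<in>{0..2*pi}. sigma_max (T_zw A B Bw C Q R K \<omega>))"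

definition hinf_opt ::
    "real^'x^'x \<Rightarrow> real^'u^'x \<Rightarrow> real^'w^'x \<Rightarrow> real^'x^'y \<Rightarrow> real^'x^'x \<Rightarrow> real^'u^'u \<Rightarrow> real" where
  "hinf_opt A B Bw C Q R = (INF K\<in>stabilizing_gains A B C. hinf_cost A B Bw C Q R K)"

definition hinf_sublevel ::
    "real^'x^'x \<Rightarrow> real^'u^'x \<Rightarrow> real^'w^'x \<Rightarrow> real^'x^'y \<Rightarrow> real^'x^'x \<Rightarrow> real^'u^'u
      \<Rightarrow> real \<Rightarrow> (real^'y^'u) set" where
  "hinf_sublevel A B Bw C Q R \<nu> =
     {K \<in> stabilizing_gains A B C. hinf_cost A B Bw C Q R K \<le> \<nu>}"

section \<open>Subdifferential and distance\<close>

text \<open>\<open>S\<close> is the open set on which \<open>f\<close> is considered; values of \<open>f\<close> outside \<open>S\<close> play no role.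
  The inner product and the norm of the type \<open>real^'n^'m\<close> are the trace inner product and
  the Frobenius norm.\<close>

definition frechet_subdifferential ::
    "'a::real_inner set \<Rightarrow> ('a \<Rightarrow> real) \<Rightarrow> 'a \<Rightarrow> 'a set" where
  "frechet_subdifferential S f x =
     {v. 0 \<le> Liminf (at x within S) (\<lambda>y. ereal ((f y - f x - v \<bullet> (y - x)) / norm (y - x)))}"

lemma inner_matrix_eq_trace:
  fixes M N :: "real^'n^'m"
  shows "M \<bullet> N = trace (transpose M ** N)"
  unfolding inner_vec_def trace_def transpose_def matrix_matrix_mult_def
  by (simp, rule sum.swap)

text \<open>Extended-real distance: the empty set is at distance \<open>\<infinity>\<close>, whereas \<^const>\<open>infdist\<close>
  would return 0.\<close>

definition edist_set :: "'a::metric_space \<Rightarrow> 'a set \<Rightarrow> ereal" where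
  "edist_set x S = (INF y\<in>S. ereal (dist x y))"

end

theory Submission
  imports Defs "HOL-Computational_Algebra.Fundamental_Theorem_Algebra"
begin

text \<open>
The cost \<open>J\<close> is not convex in the gain, but it becomes so after a change of variables, and the
argument transports a straight line of the convex picture back to the space of gains.

By the bounded real lemma, \<open>J K \<le> c\<close> holds exactly if some positive definite \<open>P\<close> satisfies the
dissipation inequality
\<open>x \<bullet> Q x + K x \<bullet> R K x - c\<^sup>2 \<parallel>w\<parallel>\<^sup>2 + V (A x + B K x + G w) \<le> V x\<close>, where \<open>V x = x \<bullet> P x\<close> and \<open>G\<close> stands
for the disturbance matrix (lemmas \<open>certificate_imp_cost_bound\<close> and \<open>cost_bound_imp_certificate\<close>).
Sufficiency is read off from harmonic responses. For necessity, \<open>V\<close> is the available storage: the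
largest payoff of a disturbance that eventually brings the state back to rest
(\<open>available_storage_exists\<close>). Surjectivity of \<open>G\<close> makes every state reachable from, and steerable to,
rest in one step. Hence the runs in question close up to periodic ones, to which a finite Fourier
transform applies (\<open>loop_energy_bound\<close>), and \<open>V\<close> lies between the stage cost and a multiple of
\<open>c\<^sup>2 \<parallel>x\<parallel>\<^sup>2\<close>. These bounds are uniform on sublevel sets of \<open>J\<close>. They bound \<open>P\<close> and, as \<open>R\<close> is positive
definite, also \<open>K\<close>; compactness then yields an optimal gain (\<open>hinf_cost_attains_min\<close>).

In the variables \<open>X = P\<^sup>-\<^sup>1\<close>, \<open>Y = K X\<close> and \<open>c\<^sup>2\<close> the dissipation inequality is a convex condition
(\<open>certifies_interpolate\<close>). Interpolating between \<open>K\<close> with level \<open>J K\<close> and an optimal gain \<open>K\<^sup>*\<close>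
therefore produces gains \<open>K\<^sub>t\<close> with \<open>(J K\<^sub>t)\<^sup>2 \<le> (1 - t) (J K)\<^sup>2 + t (J K\<^sup>*)\<^sup>2\<close>, and
\<open>K\<^sub>t - K = t (K\<^sup>* - K) X\<^sup>* P\<^sub>t\<close> has norm at most \<open>t M\<close> with one constant \<open>M\<close> for the whole sublevel set
(\<open>descent_curve\<close>). So \<open>J\<close> falls at rate at least \<open>(J K - J K\<^sup>*) / 2\<close> along a curve of speed at most \<open>M\<close>,
and every Frechet subgradient at \<open>K\<close> has norm at least \<open>(J K - J K\<^sup>*) / (2 M)\<close>
(\<open>frechet_subgradient_ge_descent_rate\<close>).
\<close>

section \<open>Symmetric matrices and the principal square root\<close>

text \<open>A maximiser of the Rayleigh quotient is an eigenvector. The version on an invariant subspace lets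
the spectral theorem be proved by splitting off one eigenvector at a time; the quotient bound is
what identifies \<^const>\<open>sigma_max\<close> with an operator norm.\<close>

lemma selfadjoint_top_eigenvector:
  fixes f :: "'a::euclidean_space \<Rightarrow> 'a"
  assumes lin: "linear f" and sa: "\<And>x y. f x \<bullet> y = x \<bullet> f y"
    and sub: "subspace S" and inv: "\<And>x. x \<in> S \<Longrightarrow> f x \<in> S" and ne: "S \<noteq> {0}"
  obtains v where "v \<in> S" "norm v = 1" "f v = (v \<bullet> f v) *\<^sub>R v"
    "\<And>x. x \<in> S \<Longrightarrow> x \<bullet> f x \<le> (v \<bullet> f v) * (norm x)\<^sup>2"
proof -
  interpret f: linear f by (rule lin)
  have contf: "continuous_on T f" for T
    using lin by (simp add: linear_continuous_on linear_conv_bounded_linear)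
  obtain y where y: "y \<in> S" "y \<noteq> 0" using ne sub subspace_0 by blast
  have "y /\<^sub>R norm y \<in> sphere 0 1 \<inter> S" using y sub by (simp add: subspace_scale)
  then have nonempty: "sphere 0 1 \<inter> S \<noteq> {}" by blast
  have "compact (sphere 0 1 \<inter> S)"
    using closed_subspace[OF sub] by (simp add: compact_Int_closed)
  moreover have "continuous_on (sphere 0 1 \<inter> S) (\<lambda>x. x \<bullet> f x)"
    by (intro continuous_intros contf)
  ultimately obtain v where v: "v \<in> sphere 0 1 \<inter> S"
    and vmax: "\<And>x. x \<in> sphere 0 1 \<inter> S \<Longrightarrow> x \<bullet> f x \<le> v \<bullet> f v"
    using continuous_attains_sup[OF _ nonempty] by blast
  define l where "l = v \<bullet> f v"
  have v1: "norm v = 1" and vS: "v \<in> S" using v by auto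
  have top: "x \<bullet> f x \<le> l * (norm x)\<^sup>2" if "x \<in> S" for x
  proof (cases "x = 0")
    case False
    have "x /\<^sub>R norm x \<in> sphere 0 1 \<inter> S" using False that sub by (simp add: subspace_scale)
    from vmax[OF this] have "(x \<bullet> f x) / (norm x)\<^sup>2 \<le> l"
      by (simp add: f.scale l_def power2_eq_square divide_inverse mult_ac)
    then show ?thesis using False by (simp add: divide_le_eq)
  qed (simp add: f.zero)
  define u where "u = l *\<^sub>R v - f v"
  have uS: "u \<in> S" unfolding u_def using sub vS inv by (simp add: subspace_scale subspace_diff)
  \<comment> \<open>The nonnegative form \<open>l * norm x ^ 2 - x \<bullet> f x\<close> vanishes at \<open>v\<close>, so its first variation
    in the direction \<open>u\<close> vanishes as well.\<close>
  have quad: "0 \<le> 2 * t * (u \<bullet> u) + t\<^sup>2 * (l * (norm u)\<^sup>2 - u \<bullet> f u)" for t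
  proof -
    have "v + t *\<^sub>R u \<in> S" using sub vS uS by (simp add: subspace_add subspace_scale)
    from top[OF this] have "0 \<le> l * ((v + t *\<^sub>R u) \<bullet> (v + t *\<^sub>R u)) - (v + t *\<^sub>R u) \<bullet> f (v + t *\<^sub>R u)"
      by (simp add: power2_norm_eq_inner)
    also have "\<dots> = (l * (v \<bullet> v) - v \<bullet> f v) + 2 * t * (l * (u \<bullet> v) - u \<bullet> f v)
        + t\<^sup>2 * (l * (u \<bullet> u) - u \<bullet> f u)"
      using sa[of v u] inner_commute[of u v] inner_commute[of u "f v"]
      by (simp add: f.add f.scale inner_add power2_eq_square algebra_simps)
    also have "l * (v \<bullet> v) - v \<bullet> f v = 0"
      using v1 by (simp add: l_def dot_square_norm)
    also have "l * (u \<bullet> v) - u \<bullet> f v = u \<bullet> u"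
      unfolding u_def by (simp add: inner_diff_right)
    finally show ?thesis by (simp add: power2_norm_eq_inner)
  qed
  have "u \<bullet> u = 0"
  proof (rule ccontr)
    assume "u \<bullet> u \<noteq> 0"
    then have pos: "0 < u \<bullet> u" by simp
    define c where "c = \<bar>l * (norm u)\<^sup>2 - u \<bullet> f u\<bar> + 1"
    \<comment> \<open>The quadratic above would be negative at this \<open>t\<close>.\<close>
    define t where "t = - (u \<bullet> u) / c"
    have c: "c > 0" by (simp add: c_def)
    have "t\<^sup>2 * (l * (norm u)\<^sup>2 - u \<bullet> f u) \<le> t\<^sup>2 * c"
      by (intro mult_left_mono) (auto simp: c_def)
    with quad[of t] have "0 \<le> 2 * t * (u \<bullet> u) + t\<^sup>2 * c" by linarith
    also have "\<dots> = - (u \<bullet> u)\<^sup>2 / c"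
      using c by (simp add: t_def field_simps power2_eq_square)
    finally show False using pos c by (simp add: field_simps)
  qed
  then have "f v = l *\<^sub>R v" by (simp add: u_def)
  with that[OF vS v1] top show ?thesis unfolding l_def by blast
qed

lemma selfadjoint_orthonormal_eigenbasis:
  fixes f :: "'a::euclidean_space \<Rightarrow> 'a"
  assumes lin: "linear f" and sa: "\<And>x y. f x \<bullet> y = x \<bullet> f y"
    and "subspace S" and "\<And>x. x \<in> S \<Longrightarrow> f x \<in> S"
  shows "\<exists>X. finite X \<and> X \<subseteq> S \<and> pairwise orthogonal X
    \<and> (\<forall>b\<in>X. norm b = 1 \<and> f b = (b \<bullet> f b) *\<^sub>R b) \<and> (\<forall>x\<in>S. x = (\<Sum>b\<in>X. (x \<bullet> b) *\<^sub>R b))"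
  using assms(3,4)
proof (induction "dim S" arbitrary: S rule: less_induct)
  case less
  interpret f: linear f by (rule lin)
  show ?case
  proof (cases "S = {0}")
    case True
    then show ?thesis by (intro exI[of _ "{}"]) auto
  next
    case False
    obtain v where v: "v \<in> S" "norm v = 1" "f v = (v \<bullet> f v) *\<^sub>R v"
      using selfadjoint_top_eigenvector[OF lin sa less.prems False] by metis
    have vv: "v \<bullet> v = 1" using v(2) by (simp add: dot_square_norm)
    define T where "T = S \<inter> {x. v \<bullet> x = 0}"
    have subT: "subspace T"
      unfolding T_def by (intro subspace_inter less.prems subspace_hyperplane)
    have "v \<notin> T" using vv by (simp add: T_def)
    then have "T \<subset> S" using v(1) unfolding T_def by blast
    then have dimT: "dim T < dim S"
      using dim_psubset[of T S] subT less.prems(1) by (metis span_eq_iff)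
    have invT: "f x \<in> T" if "x \<in> T" for x
    proof -
      have "f v \<bullet> x = (v \<bullet> f v) * (v \<bullet> x)" by (subst v(3)) simp
      then have "v \<bullet> f x = 0" using that sa[of v x] by (simp add: T_def)
      then show ?thesis using that less.prems(2) by (simp add: T_def)
    qed
    obtain X where X: "finite X" "X \<subseteq> T" "pairwise orthogonal X"
        "\<forall>b\<in>X. norm b = 1 \<and> f b = (b \<bullet> f b) *\<^sub>R b"
        "\<forall>x\<in>T. x = (\<Sum>b\<in>X. (x \<bullet> b) *\<^sub>R b)"
      using less.hyps[OF dimT subT invT] by blast
    have vX: "v \<notin> X" using X(2) \<open>v \<notin> T\<close> by auto
    have orth: "orthogonal v b" if "b \<in> X" for b
      using that X(2) by (auto simp: T_def orthogonal_def)
    have expand: "x = (\<Sum>b\<in>insert v X. (x \<bullet> b) *\<^sub>R b)" if "x \<in> S" for x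
    proof -
      define y where "y = x - (x \<bullet> v) *\<^sub>R v"
      have "y \<in> T" using that v(1) vv less.prems(1)
        unfolding y_def T_def
        by (simp add: subspace_diff subspace_scale inner_diff_right inner_commute[of x v])
      then have "y = (\<Sum>b\<in>X. (y \<bullet> b) *\<^sub>R b)" using X(5) by blast
      also have "\<dots> = (\<Sum>b\<in>X. (x \<bullet> b) *\<^sub>R b)"
        using orth by (intro sum.cong) (auto simp: y_def inner_diff_left orthogonal_def)
      finally show ?thesis using X(1) vX by (simp add: y_def algebra_simps)
    qed
    show ?thesis
    proof (intro exI conjI)
      show "finite (insert v X)" using X(1) by simp
      show "insert v X \<subseteq> S" using v(1) X(2) by (auto simp: T_def)
      show "pairwise orthogonal (insert v X)"
        using X(3) orth by (auto simp: pairwise_insert orthogonal_commute)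
      show "\<forall>b\<in>insert v X. norm b = 1 \<and> f b = (b \<bullet> f b) *\<^sub>R b"
        using X(4) v(2,3) by blast
      show "\<forall>x\<in>S. x = (\<Sum>b\<in>insert v X. (x \<bullet> b) *\<^sub>R b)"
        using expand by blast
    qed
  qed
qed

lemma symmetric_mat_inner:
  fixes M :: "real^'n^'n"
  assumes "symmetric_mat M"
  shows "(M *v x) \<bullet> y = x \<bullet> (M *v y)"
  by (metis assms dot_lmul_matrix inner_commute symmetric_mat_def transpose_matrix_vector)

lemma pos_def_imp_pos_semidef: "pos_def M \<Longrightarrow> pos_semidef M"
  unfolding pos_def_def pos_semidef_def by (metis inner_zero_left less_eq_real_def)

lemma symmetric_matI:
  fixes M :: "real^'n^'n"
  assumes "\<And>x y. (M *v x) \<bullet> y = x \<bullet> (M *v y)"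
  shows "symmetric_mat M"
proof -
  have "transpose M *v x = M *v x" for x
  proof -
    have "(transpose M *v x) \<bullet> y = (M *v x) \<bullet> y" for y
      by (metis assms dot_lmul_matrix transpose_matrix_vector)
    then show ?thesis using vector_eq_rdot by blast
  qed
  then show ?thesis unfolding symmetric_mat_def by (simp add: matrix_eq)
qed

lemma pos_semidef_sqrt_exists:
  fixes M :: "real^'n^'n"
  assumes "pos_semidef M"
  shows "\<exists>S. pos_semidef S \<and> S ** S = M"
proof -
  have sym: "symmetric_mat M" and nonneg: "\<And>x. 0 \<le> x \<bullet> (M *v x)"
    using assms by (auto simp: pos_semidef_def)
  obtain X where X: "finite X" "pairwise orthogonal X"
    "\<And>b. b \<in> X \<Longrightarrow> norm b = 1 \<and> M *v b = (b \<bullet> (M *v b)) *\<^sub>R b"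
    "\<And>x. x = (\<Sum>b\<in>X. (x \<bullet> b) *\<^sub>R b)"
    using selfadjoint_orthonormal_eigenbasis[OF matrix_vector_mul_linear[of M]
        symmetric_mat_inner[OF sym] subspace_UNIV UNIV_I] by blast
  have XX: "b \<bullet> c = (if b = c then 1 else 0)" if "b \<in> X" "c \<in> X" for b c
    using X(2) X(3)[OF that(1)] that
    by (auto simp: pairwise_def orthogonal_def dot_square_norm)
  define r where "r b = sqrt (b \<bullet> (M *v b))" for b
  define g where "g x = (\<Sum>b\<in>X. (r b * (x \<bullet> b)) *\<^sub>R b)" for x
  have lin: "linear g"
    by (rule linearI) (simp_all add: g_def inner_add algebra_simps sum.distrib scaleR_sum_right)
  have gb: "g b = r b *\<^sub>R b" if "b \<in> X" for b
  proof -
    have "g b = (\<Sum>c\<in>X. if c = b then r b *\<^sub>R b else 0)"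
      unfolding g_def using XX[OF that] by (intro sum.cong) auto
    then show ?thesis using X(1) that by simp
  qed
  have gg: "g (g x) = M *v x" for x
  proof -
    have "g (g x) = (\<Sum>b\<in>X. (r b * (x \<bullet> b)) *\<^sub>R g b)"
      by (subst (2) g_def) (simp add: linear_sum[OF lin] linear_scale[OF lin])
    also have "\<dots> = (\<Sum>b\<in>X. (x \<bullet> b) *\<^sub>R (M *v b))"
    proof (intro sum.cong refl)
      fix b assume b: "b \<in> X"
      have "r b * r b = b \<bullet> (M *v b)" using nonneg by (simp add: r_def)
      then show "(r b * (x \<bullet> b)) *\<^sub>R g b = (x \<bullet> b) *\<^sub>R (M *v b)"
        using X(3)[OF b] by (metis (no_types, lifting) b gb mult.commute mult.left_commute scaleR_scaleR)
    qed
    also have "\<dots> = M *v (\<Sum>b\<in>X. (x \<bullet> b) *\<^sub>R b)"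
      by (simp add: linear_sum[OF matrix_vector_mul_linear] matrix_vector_mult_scaleR)
    finally show ?thesis using X(4)[of x, symmetric] by (simp only:)
  qed
  define S where "S = matrix g"
  have Sg: "S *v x = g x" for x unfolding S_def by (simp add: lin matrix_works)
  have "pos_semidef S"
    unfolding pos_semidef_def
  proof (intro conjI allI)
    show "symmetric_mat S"
      by (rule symmetric_matI)
        (simp add: Sg g_def inner_sum_left inner_sum_right inner_commute mult_ac)
    fix x
    have "x \<bullet> (S *v x) = (\<Sum>b\<in>X. r b * (x \<bullet> b)\<^sup>2)"
      by (simp add: Sg g_def inner_sum_right power2_eq_square mult_ac)
    also have "\<dots> \<ge> 0" by (intro sum_nonneg) (simp add: r_def nonneg)
    finally show "0 \<le> x \<bullet> (S *v x)" .
  qed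
  moreover have "S ** S = M"
    by (simp add: matrix_eq gg Sg flip: matrix_vector_mul_assoc)
  ultimately show ?thesis by blast
qed

text \<open>Let \<open>v\<close> be a top eigenvector of \<open>S - T\<close> with eigenvalue \<open>m\<close>. Since \<open>S\<^sup>2 = T\<^sup>2\<close>, the vectors
\<open>S v\<close> and \<open>T v\<close> have the same length, so \<open>S v - T v = m v\<close> is orthogonal to \<open>S v + T v\<close>. If
\<open>m > 0\<close>, the nonnegative numbers \<open>v \<bullet> S v\<close> and \<open>v \<bullet> T v\<close> then have sum zero, which contradicts
\<open>v \<bullet> (S - T) v = m\<close>. Hence the form of \<open>S - T\<close> is nonpositive, and by symmetry zero.\<close>

lemma pos_semidef_sqrt_unique:
  fixes S T :: "real^'n^'n"
  assumes S: "pos_semidef S" and T: "pos_semidef T" and eq: "S ** S = T ** T"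
  shows "S = T"
proof (rule ccontr)
  have no_pos: "x \<bullet> (S *v x) \<le> x \<bullet> (T *v x)"
    if S: "pos_semidef S" and T: "pos_semidef T" and eq: "S ** S = T ** T" for S T :: "real^'n^'n" and x
  proof -
    let ?D = "S - T"
    have sS: "symmetric_mat S" and sT: "symmetric_mat T"
      using S T by (auto simp: pos_semidef_def)
    have sa: "(?D *v x) \<bullet> y = x \<bullet> (?D *v y)" for x y
      by (simp add: matrix_vector_mult_diff_rdistrib inner_diff symmetric_mat_inner sS sT)
    obtain v where v: "norm v = 1" "?D *v v = (v \<bullet> (?D *v v)) *\<^sub>R v"
      "\<And>x. x \<bullet> (?D *v x) \<le> (v \<bullet> (?D *v v)) * (norm x)\<^sup>2"
    proof -
      have "axis undefined 1 \<noteq> (0::real^'n)" by (simp add: axis_eq_0_iff)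
      then have "(UNIV :: (real^'n) set) \<noteq> {0}" by blast
      then show ?thesis
        using selfadjoint_top_eigenvector[OF matrix_vector_mul_linear[of ?D] sa subspace_UNIV UNIV_I]
          UNIV_I that by metis
    qed
    define m where "m = v \<bullet> (?D *v v)"
    have m: "S *v v - T *v v = m *\<^sub>R v"
      unfolding m_def by (subst v(2)[symmetric]) (simp add: matrix_vector_mult_diff_rdistrib)
    have "m \<le> 0"
    proof (rule ccontr)
      assume "\<not> m \<le> 0"
      have "S *v (S *v v) = T *v (T *v v)" by (simp add: matrix_vector_mul_assoc eq)
      then have "(S *v v) \<bullet> (S *v v) = (T *v v) \<bullet> (T *v v)"
        by (simp add: symmetric_mat_inner sS sT)
      then have "0 = (S *v v - T *v v) \<bullet> (S *v v + T *v v)"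
        by (simp add: inner_diff_left inner_diff_right inner_add_right inner_add_left inner_commute)
      also have "\<dots> = m * (v \<bullet> (S *v v) + v \<bullet> (T *v v))"
        by (simp add: m inner_add_right distrib_left)
      finally have "v \<bullet> (S *v v) + v \<bullet> (T *v v) = 0"
        using \<open>\<not> m \<le> 0\<close> by simp
      moreover have "0 \<le> v \<bullet> (S *v v)" "0 \<le> v \<bullet> (T *v v)" using S T by (auto simp: pos_semidef_def)
      ultimately have "v \<bullet> (?D *v v) = 0"
        by (simp add: matrix_vector_mult_diff_rdistrib inner_diff)
      then show False using \<open>\<not> m \<le> 0\<close> by (simp add: m_def)
    qed
    then have "x \<bullet> (?D *v x) \<le> 0"
      using v(3)[of x] by (smt (verit) m_def mult_nonpos_nonneg zero_le_power2)
    then show ?thesis by (simp add: matrix_vector_mult_diff_rdistrib inner_diff)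
  qed
  assume "S \<noteq> T"
  have eqq: "x \<bullet> (S *v x) = x \<bullet> (T *v x)" for x
    using no_pos[OF S T eq] no_pos[OF T S eq[symmetric]] by (meson antisym)
  have sS: "symmetric_mat S" and sT: "symmetric_mat T"
    using S T by (auto simp: pos_semidef_def)
  have "x \<bullet> (S *v y) = x \<bullet> (T *v y)" for x y
    using eqq[of "x + y"] eqq[of x] eqq[of y] symmetric_mat_inner[OF sS, of x y]
      symmetric_mat_inner[OF sT, of x y]
    by (simp add: matrix_vector_right_distrib inner_add inner_commute)
  then have "S *v y = T *v y" for y by (metis vector_eq_ldot)
  then show False using \<open>S \<noteq> T\<close> by (simp add: matrix_eq)
qed

text \<open>The only way in which the square roots enter: the performance output has the energy
\<open>x \<bullet> Q x + u \<bullet> R u\<close>.\<close>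

lemma norm_psd_sqrt:
  fixes M :: "real^'n^'n"
  assumes "pos_semidef M"
  shows "(norm (psd_sqrt M *v x))\<^sup>2 = x \<bullet> (M *v x)"
proof -
  have "\<exists>!S. pos_semidef S \<and> S ** S = M"
    using pos_semidef_sqrt_exists[OF assms] pos_semidef_sqrt_unique by metis
  then have S: "pos_semidef (psd_sqrt M) \<and> psd_sqrt M ** psd_sqrt M = M"
    unfolding psd_sqrt_def by (rule theI')
  then show ?thesis
    by (metis matrix_vector_mul_assoc pos_semidef_def power2_norm_eq_inner symmetric_mat_inner)
qed

lemma pos_def_coercive:
  fixes M :: "real^'n^'n"
  assumes "pos_def M"
  obtains q where "q > 0" "\<And>x. q * (norm x)\<^sup>2 \<le> x \<bullet> (M *v x)"
proof -
  let ?f = "\<lambda>x. - (M *v x)"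
  have sa: "?f x \<bullet> y = x \<bullet> ?f y" for x y
    using assms by (simp add: pos_def_def symmetric_mat_inner)
  have ne: "(UNIV :: (real^'n) set) \<noteq> {0}"
    using axis_eq_0_iff[of undefined "1::real"] by (metis UNIV_I singletonD zero_neq_one)
  have lin: "linear ?f" by (intro linear_compose_neg matrix_vector_mul_linear)
  obtain v where v: "norm v = 1" "\<And>x. x \<bullet> ?f x \<le> (v \<bullet> ?f v) * (norm x)\<^sup>2"
    using selfadjoint_top_eigenvector[OF lin sa subspace_UNIV UNIV_I ne] UNIV_I by metis
  show ?thesis
  proof
    show "0 < v \<bullet> (M *v v)" using assms v(1) unfolding pos_def_def by (metis norm_zero zero_neq_one)
    show "(v \<bullet> (M *v v)) * (norm x)\<^sup>2 \<le> x \<bullet> (M *v x)" for x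
      using v(2)[of x] by simp
  qed
qed

section \<open>The largest singular value and the frequency response\<close>

definition re_vec :: "complex^'n \<Rightarrow> real^'n" where "re_vec v = (\<chi> i. Re (v $ i))"
definition im_vec :: "complex^'n \<Rightarrow> real^'n" where "im_vec v = (\<chi> i. Im (v $ i))"

lemma complex_vec_of_parts: "\<exists>v. re_vec v = a \<and> im_vec v = b"
  by (rule exI[of _ "\<chi> i. Complex (a $ i) (b $ i)"]) (simp add: re_vec_def im_vec_def)

lemma complex_vec_eq_iff: "v = w \<longleftrightarrow> re_vec v = re_vec w \<and> im_vec v = im_vec w"
  by (auto simp: re_vec_def im_vec_def vec_eq_iff complex_eq_iff)

lemma norm_complex_vec: "(norm v)\<^sup>2 = (norm (re_vec v))\<^sup>2 + (norm (im_vec v))\<^sup>2"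
  for v :: "complex^'n"
  by (simp add: norm_vec_def L2_set_def sum_nonneg re_vec_def im_vec_def cmod_power2 sum.distrib)

lemma re_im_vec_simps:
  "re_vec (v + w) = re_vec v + re_vec w" "im_vec (v + w) = im_vec v + im_vec w"
  "re_vec (complex_matrix M *v v) = M *v re_vec v" "im_vec (complex_matrix M *v v) = M *v im_vec v"
  "re_vec (c *s v) = Re c *\<^sub>R re_vec v - Im c *\<^sub>R im_vec v"
  "im_vec (c *s v) = Im c *\<^sub>R re_vec v + Re c *\<^sub>R im_vec v"
  by (simp_all add: re_vec_def im_vec_def vec_eq_iff complex_matrix_def matrix_vector_mult_def)

lemma mat_mult_vec: "mat c *v v = c *s v" for c :: "'a::comm_semiring_1"
  by (simp add: mat_def matrix_vector_mult_def vec_eq_iff if_distrib if_distribR cong: if_cong)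

lemma linear_complex_matrix_vector: "linear ((*v) M)" for M :: "complex^'n^'m"
proof (rule linearI)
  show "M *v (c *\<^sub>R x) = c *\<^sub>R (M *v x)" for c x
    by (simp add: vec_eq_iff matrix_vector_mult_def scaleR_sum_right)
qed (rule matrix_vector_right_distrib)

lemma inner_conj_transpose:
  fixes M :: "complex^'n^'m"
  shows "(M *v x) \<bullet> y = x \<bullet> (conj_transpose M *v y)"
proof -
  have re: "a \<bullet> b = Re (a * cnj b)" for a b :: complex by (simp add: inner_complex_def)
  have "(M *v x) \<bullet> y = (\<Sum>i\<in>UNIV. \<Sum>j\<in>UNIV. Re (M $ i $ j * x $ j * cnj (y $ i)))"
    by (simp only: inner_vec_def re matrix_vector_mult_def vec_lambda_beta sum_distrib_right Re_sum)
  also have "\<dots> = (\<Sum>j\<in>UNIV. \<Sum>i\<in>UNIV. Re (M $ i $ j * x $ j * cnj (y $ i)))"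
    by (rule sum.swap)
  also have "\<dots> = x \<bullet> (conj_transpose M *v y)"
    unfolding inner_vec_def re matrix_vector_mult_def vec_lambda_beta conj_transpose_def
      cnj_sum sum_distrib_left Re_sum
    by (intro sum.cong refl) (simp add: algebra_simps)
  finally show ?thesis .
qed

text \<open>The top eigenvector of \<open>M\<^sup>* M\<close>, self-adjoint for the real inner product of \<open>\<complex>\<^sup>n\<close>, is a unit vector
that \<open>M\<close> stretches most, and the stretching factor is a singular value that dominates the others.
Eigenvectors for distinct singular values are orthogonal, so there are only finitely many singular
values and the \<^const>\<open>Max\<close> in the definition of \<^const>\<open>sigma_max\<close> is genuine.\<close>

lemma sigma_max_is_operator_norm:
  fixes M :: "complex^'n^'m"
  shows "norm (M *v x) \<le> sigma_max M * norm x"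
    and "\<exists>v. norm v = 1 \<and> norm (M *v v) = sigma_max M"
proof -
  define H where "H = conj_transpose M ** M"
  have HM: "x \<bullet> (H *v y) = (M *v x) \<bullet> (M *v y)" for x y
    by (simp add: H_def inner_conj_transpose flip: matrix_vector_mul_assoc)
  have sa: "(H *v x) \<bullet> y = x \<bullet> (H *v y)" for x y
    by (metis HM inner_commute)
  have scale: "(of_real r :: complex) *s v = r *\<^sub>R v" for r :: real and v :: "complex^'n"
    unfolding vec_eq_iff vector_scaleR_component vector_smult_component
    by (simp add: scaleR_conv_of_real)
  have ne: "(UNIV :: (complex^'n) set) \<noteq> {0}"
    using axis_eq_0_iff[of undefined "1::complex"] by (metis UNIV_I singletonD zero_neq_one)
  obtain v where v: "norm v = 1" "H *v v = (v \<bullet> (H *v v)) *\<^sub>R v"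
      "\<And>x. x \<bullet> (H *v x) \<le> (v \<bullet> (H *v v)) * (norm x)\<^sup>2"
    using selfadjoint_top_eigenvector[OF linear_complex_matrix_vector sa subspace_UNIV UNIV_I ne]
      UNIV_I by metis
  define s where "s = norm (M *v v)"
  have s2: "v \<bullet> (H *v v) = s\<^sup>2" by (simp add: HM s_def power2_norm_eq_inner)
  have Hv: "H *v v = of_real (s\<^sup>2) *s v" using v(2) unfolding s2 scale .
  have top: "norm (M *v x) \<le> s * norm x" for x
  proof (rule power2_le_imp_le)
    show "(norm (M *v x))\<^sup>2 \<le> (s * norm x)\<^sup>2"
      using v(3)[of x] unfolding s2 by (simp add: HM power2_norm_eq_inner power_mult_distrib)
  qed (simp add: s_def)
  have sv: "s \<in> singular_values M"
  proof -
    have "v \<noteq> 0" using v(1) by auto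
    then show ?thesis unfolding singular_values_def mat_eigenvalue_def H_def[symmetric]
      using Hv by (auto simp: s_def)
  qed
  have ev: "\<exists>u. u \<noteq> 0 \<and> H *v u = t\<^sup>2 *\<^sub>R u" if "t \<in> singular_values M" for t
    using that unfolding singular_values_def mat_eigenvalue_def H_def[symmetric] scale by blast
  have le: "t \<le> s" if t: "t \<in> singular_values M" for t
  proof -
    obtain u where u: "u \<noteq> 0" "H *v u = t\<^sup>2 *\<^sub>R u" using ev[OF t] by blast
    have "(norm (M *v u))\<^sup>2 = u \<bullet> (H *v u)" by (simp add: HM power2_norm_eq_inner)
    also have "\<dots> = (t * norm u)\<^sup>2"
      by (simp add: u(2) power_mult_distrib power2_norm_eq_inner)
    finally have "norm (M *v u) = t * norm u"
      using t by (simp add: singular_values_def power2_eq_iff_nonneg)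
    with top[of u] u(1) show ?thesis by simp
  qed
  have fin: "finite (singular_values M)"
  proof -
    define u where "u t = (SOME u. u \<noteq> 0 \<and> H *v u = t\<^sup>2 *\<^sub>R u)" for t
    have u: "u t \<noteq> 0 \<and> H *v u t = t\<^sup>2 *\<^sub>R u t" if "t \<in> singular_values M" for t
      unfolding u_def by (rule someI_ex) (rule ev[OF that])
    have orth: "u t \<bullet> u t' = 0" if "t \<in> singular_values M" "t' \<in> singular_values M" "t \<noteq> t'" for t t'
    proof -
      have "t\<^sup>2 * (u t \<bullet> u t') = t'\<^sup>2 * (u t \<bullet> u t')"
        using sa[of "u t" "u t'"] u[OF that(1)] u[OF that(2)] by simp
      moreover have "t\<^sup>2 \<noteq> t'\<^sup>2"
        using that by (simp add: singular_values_def power2_eq_iff_nonneg)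
      ultimately show ?thesis by simp
    qed
    have "inj_on u (singular_values M)"
      by (rule inj_onI) (metis orth u inner_eq_zero_iff)
    moreover have "pairwise orthogonal (u ` singular_values M)"
      using orth unfolding pairwise_def orthogonal_def by blast
    ultimately show ?thesis
      using pairwise_orthogonal_imp_finite finite_image_iff by blast
  qed
  have smax: "sigma_max M = s"
    unfolding sigma_max_def by (rule Max_eqI[OF fin le sv])
  show "norm (M *v x) \<le> sigma_max M * norm x" using top smax by simp
  show "\<exists>v. norm v = 1 \<and> norm (M *v v) = sigma_max M" using v(1) smax s_def by (intro exI[of _ v]) simp
qed

lemma sigma_max_nonneg: "0 \<le> sigma_max M"
  using sigma_max_is_operator_norm(2) norm_ge_zero by metis

lemma sigma_max_le:
  assumes "\<And>v. norm (M *v v) \<le> c * norm v"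
  shows "sigma_max M \<le> c"
  using sigma_max_is_operator_norm(2)[of M] assms by (metis mult.right_neutral)

definition transfer :: "real^'x^'x \<Rightarrow> real^'w^'x \<Rightarrow> real^'x^'z \<Rightarrow> real \<Rightarrow> complex^'w^'z" where
  "transfer F G E \<omega> =
     complex_matrix E ** matrix_inv (mat (exp (\<i> * complex_of_real \<omega>)) - complex_matrix F)
       ** complex_matrix G"

text \<open>\<open>a + \<i> b\<close> is the amplitude of the harmonic response to the input amplitude \<open>p + \<i> q\<close>.\<close>

definition harmonic ::
    "real^'x^'x \<Rightarrow> real^'w^'x \<Rightarrow> real \<Rightarrow> real^'x \<Rightarrow> real^'x \<Rightarrow> real^'w \<Rightarrow> real^'w \<Rightarrow> bool" where
  "harmonic F G \<omega> a b p q \<longleftrightarrow>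
     F *v a + G *v p = cos \<omega> *\<^sub>R a - sin \<omega> *\<^sub>R b \<and>
     F *v b + G *v q = sin \<omega> *\<^sub>R a + cos \<omega> *\<^sub>R b"

text \<open>A uniform lower bound on the unit circle, obtained by compactness of frequencies times unit
vectors, keeps the frequency response bounded; otherwise the supremum that defines the cost would
be meaningless.\<close>

lemma schur_stable_resolvent:
  fixes F :: "real^'x^'x"
  assumes "schur_stable F"
  defines "N \<equiv> \<lambda>\<omega>. mat (exp (\<i> * complex_of_real \<omega>)) - complex_matrix F"
  shows "matrix_inv (N \<omega>) *v (N \<omega> *v v) = v" "N \<omega> *v (matrix_inv (N \<omega>) *v v) = v"
    and "\<exists>d>0. \<forall>\<omega>\<in>{0..2*pi}. \<forall>v. d * norm v \<le> norm (N \<omega> *v v)"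
proof -
  have Nv: "N \<omega> *v v = exp (\<i> * complex_of_real \<omega>) *s v - complex_matrix F *v v" for \<omega> v
    by (simp add: N_def matrix_vector_mult_diff_rdistrib mat_mult_vec)
  have ker: "v = 0" if "N \<omega> *v v = 0" for \<omega> v
  proof (rule ccontr)
    assume "v \<noteq> 0"
    then have "mat_eigenvalue (complex_matrix F) (exp (\<i> * complex_of_real \<omega>))"
      using that unfolding Nv mat_eigenvalue_def by auto
    then show False using assms(1) by (force simp: schur_stable_def)
  qed
  have "\<exists>N'. N' ** N \<omega> = mat 1" using ker[of \<omega>] by (simp add: matrix_left_invertible_ker)
  then have "\<exists>N'. N \<omega> ** N' = mat 1 \<and> N' ** N \<omega> = mat 1" by (metis matrix_left_right_inverse)
  then have "N \<omega> ** matrix_inv (N \<omega>) = mat 1 \<and> matrix_inv (N \<omega>) ** N \<omega> = mat 1"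
    unfolding matrix_inv_def by (rule someI_ex)
  then show "matrix_inv (N \<omega>) *v (N \<omega> *v v) = v" "N \<omega> *v (matrix_inv (N \<omega>) *v v) = v"
    by (simp_all add: matrix_vector_mul_assoc)
  define h where "h = (\<lambda>(\<omega>, v). norm (N \<omega> *v v))"
  have "compact ({0..2*pi} \<times> sphere (0::complex^'x) 1)"
    by (intro compact_Times compact_Icc compact_sphere)
  moreover have "continuous_on ({0..2*pi} \<times> sphere (0::complex^'x) 1) h"
    unfolding h_def case_prod_unfold Nv
    unfolding vector_scalar_mult_def matrix_vector_mult_def
    by (intro continuous_intros)
  moreover have "{0..2*pi} \<times> sphere (0::complex^'x) 1 \<noteq> {}"
    using vector_choose_size[of 1, where ?'a = "complex^'x"] by auto
  ultimately obtain m where m: "m \<in> {0..2*pi} \<times> sphere (0::complex^'x) 1"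
      "\<And>y. y \<in> {0..2*pi} \<times> sphere (0::complex^'x) 1 \<Longrightarrow> h m \<le> h y"
    using continuous_attains_inf by metis
  have pos: "h m > 0"
    using m(1) ker by (fastforce simp: h_def)
  have "h m * norm v \<le> norm (N \<omega> *v v)" if "\<omega> \<in> {0..2*pi}" for \<omega> v
  proof (cases "v = 0")
    case False
    have "h m \<le> h (\<omega>, v /\<^sub>R norm v)" using that False by (intro m(2)) auto
    also have "\<dots> = norm (N \<omega> *v v) / norm v"
      by (simp add: h_def linear_scale[OF linear_complex_matrix_vector] divide_inverse)
    finally show ?thesis using False by (simp add: field_simps)
  qed simp
  then show "\<exists>d>0. \<forall>\<omega>\<in>{0..2*pi}. \<forall>v. d * norm v \<le> norm (N \<omega> *v v)" using pos by blast
qed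

lemma sigma_max_transfer_bounded:
  assumes "schur_stable F"
  shows "bdd_above ((\<lambda>\<omega>. sigma_max (transfer F G E \<omega>)) ` {0..2*pi})"
proof -
  let ?N = "\<lambda>\<omega>. mat (exp (\<i> * complex_of_real \<omega>)) - complex_matrix F"
  obtain d where d: "d > 0" "\<And>\<omega> v. \<omega> \<in> {0..2*pi} \<Longrightarrow> d * norm v \<le> norm (?N \<omega> *v v)"
    using schur_stable_resolvent(3)[OF assms] by blast
  obtain e where e: "e > 0" "\<And>v. norm (complex_matrix E *v v) \<le> e * norm v"
    using linear_bounded_pos[OF linear_complex_matrix_vector] by blast
  obtain g where g: "g > 0" "\<And>v. norm (complex_matrix G *v v) \<le> g * norm v"
    using linear_bounded_pos[OF linear_complex_matrix_vector] by blast
  have "sigma_max (transfer F G E \<omega>) \<le> e * (g / d)" if \<omega>: "\<omega> \<in> {0..2*pi}" for \<omega>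
  proof (rule sigma_max_le)
    fix w
    define x where "x = matrix_inv (?N \<omega>) *v (complex_matrix G *v w)"
    have "norm x \<le> norm (?N \<omega> *v x) / d" using d(2)[OF \<omega>, of x] d(1) by (simp add: field_simps)
    also have "?N \<omega> *v x = complex_matrix G *v w"
      unfolding x_def by (rule schur_stable_resolvent(2)[OF assms])
    also have "norm \<dots> / d \<le> g * norm w / d" using g(2) d(1) by (simp add: divide_right_mono)
    finally have "norm x \<le> g / d * norm w" by simp
    have "norm (transfer F G E \<omega> *v w) = norm (complex_matrix E *v x)"
      by (simp add: transfer_def x_def matrix_vector_mul_assoc matrix_mul_assoc)
    also have "\<dots> \<le> e * norm x" by (rule e(2))
    also have "\<dots> \<le> e * (g / d * norm w)"
      using \<open>norm x \<le> g / d * norm w\<close> e(1) by (intro mult_left_mono) auto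
    finally show "norm (transfer F G E \<omega> *v w) \<le> e * (g / d) * norm w" by simp
  qed
  then show ?thesis by (intro bdd_aboveI2)
qed

text \<open>Reading a gain bound at one frequency as a statement about real harmonic responses removes complex
matrices and inverses from the rest of the argument.\<close>

lemma sigma_max_transfer_le_iff:
  fixes F :: "real^'x^'x" and G :: "real^'w^'x" and E :: "real^'x^'z"
  assumes stab: "schur_stable F" and c: "0 \<le> c"
  shows "sigma_max (transfer F G E \<omega>) \<le> c \<longleftrightarrow>
    (\<forall>a b p q. harmonic F G \<omega> a b p q \<longrightarrow>
      (norm (E *v a))\<^sup>2 + (norm (E *v b))\<^sup>2 \<le> c\<^sup>2 * ((norm p)\<^sup>2 + (norm q)\<^sup>2))"
proof -
  let ?l = "exp (\<i> * complex_of_real \<omega>)"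
  let ?N = "mat ?l - complex_matrix F"
  have l: "Re ?l = cos \<omega>" "Im ?l = sin \<omega>" by (simp_all flip: cis_conv_exp)
  have harm: "harmonic F G \<omega> (re_vec x) (im_vec x) (re_vec w) (im_vec w) \<longleftrightarrow>
      ?N *v x = complex_matrix G *v w" for x w
  proof -
    have "?N *v x = complex_matrix G *v w \<longleftrightarrow>
        complex_matrix F *v x + complex_matrix G *v w = ?l *s x"
      by (auto simp: matrix_vector_mult_diff_rdistrib mat_mult_vec algebra_simps)
    also have "\<dots> \<longleftrightarrow> harmonic F G \<omega> (re_vec x) (im_vec x) (re_vec w) (im_vec w)"
      unfolding complex_vec_eq_iff harmonic_def re_im_vec_simps l by simp
    finally show ?thesis by simp
  qed
  have out: "transfer F G E \<omega> *v w = complex_matrix E *v x"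
    if "?N *v x = complex_matrix G *v w" for x w
  proof -
    have "transfer F G E \<omega> *v w = complex_matrix E *v (matrix_inv ?N *v (complex_matrix G *v w))"
      by (simp add: transfer_def matrix_vector_mul_assoc matrix_mul_assoc)
    also have "\<dots> = complex_matrix E *v x"
      by (simp only: that[symmetric] schur_stable_resolvent(1)[OF stab])
    finally show ?thesis .
  qed
  have nE: "(norm (complex_matrix E *v x))\<^sup>2 = (norm (E *v re_vec x))\<^sup>2 + (norm (E *v im_vec x))\<^sup>2" for x
    by (simp add: norm_complex_vec re_im_vec_simps)
  have sq: "norm (complex_matrix E *v x) \<le> c * norm w \<longleftrightarrow>
      (norm (E *v re_vec x))\<^sup>2 + (norm (E *v im_vec x))\<^sup>2
        \<le> c\<^sup>2 * ((norm (re_vec w))\<^sup>2 + (norm (im_vec w))\<^sup>2)" for x and w :: "complex^'w"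
  proof -
    have "norm (complex_matrix E *v x) \<le> c * norm w \<longleftrightarrow>
        (norm (complex_matrix E *v x))\<^sup>2 \<le> (c * norm w)\<^sup>2"
      using c by (simp add: abs_le_square_iff[symmetric] del: power_mult_distrib)
    then show ?thesis by (simp add: nE power_mult_distrib norm_complex_vec[of w])
  qed
  show ?thesis
  proof (intro iffI allI impI)
    fix a b p q
    assume le: "sigma_max (transfer F G E \<omega>) \<le> c" and h: "harmonic F G \<omega> a b p q"
    obtain x w where x: "a = re_vec x" "b = im_vec x" and w: "p = re_vec w" "q = im_vec w"
      using complex_vec_of_parts by metis
    have "norm (complex_matrix E *v x) \<le> sigma_max (transfer F G E \<omega>) * norm w"
      using out[of x w] harm h x w sigma_max_is_operator_norm(1) by metis
    also have "\<dots> \<le> c * norm w" using le by (simp add: mult_right_mono)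
    finally show "(norm (E *v a))\<^sup>2 + (norm (E *v b))\<^sup>2 \<le> c\<^sup>2 * ((norm p)\<^sup>2 + (norm q)\<^sup>2)"
      unfolding sq x w .
  next
    assume r: "\<forall>a b p q. harmonic F G \<omega> a b p q \<longrightarrow>
      (norm (E *v a))\<^sup>2 + (norm (E *v b))\<^sup>2 \<le> c\<^sup>2 * ((norm p)\<^sup>2 + (norm q)\<^sup>2)"
    show "sigma_max (transfer F G E \<omega>) \<le> c"
    proof (rule sigma_max_le)
      fix w
      let ?x = "matrix_inv ?N *v (complex_matrix G *v w)"
      have N: "?N *v ?x = complex_matrix G *v w" by (rule schur_stable_resolvent(2)[OF stab])
      then have "norm (complex_matrix E *v ?x) \<le> c * norm w" unfolding sq using r harm by blast
      then show "norm (transfer F G E \<omega> *v w) \<le> c * norm w" using out[OF N] by simp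
    qed
  qed
qed

section \<open>Powers of a Schur stable matrix\<close>

text \<open>From an index on at which \<open>e\<close> stays below \<open>(1 - r) d\<close>, the excess of \<open>a\<close> over \<open>d\<close> contracts by the
factor \<open>r\<close>.\<close>

lemma contracting_recursion_tendsto_0:
  fixes a e :: "nat \<Rightarrow> real"
  assumes r: "0 \<le> r" "r < 1" and a: "\<And>n. 0 \<le> a n" and rec: "\<And>n. a (Suc n) \<le> r * a n + e n"
    and e: "e \<longlonglongrightarrow> 0"
  shows "a \<longlonglongrightarrow> 0"
proof (rule LIMSEQ_I)
  fix s :: real assume "0 < s"
  define d where "d = s / 2"
  have d: "d > 0" using \<open>0 < s\<close> by (simp add: d_def)
  then have "0 < (1 - r) * d" using r by simp
  then obtain N where N: "\<And>n. n \<ge> N \<Longrightarrow> \<bar>e n\<bar> < (1 - r) * d"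
    using LIMSEQ_D[OF e] by force
  have step: "a (N + k) \<le> d + r ^ k * a N" for k
  proof (induction k)
    case 0
    then show ?case using d by simp
  next
    case (Suc k)
    have "a (N + Suc k) \<le> r * a (N + k) + e (N + k)" using rec by simp
    also have "\<dots> \<le> r * (d + r ^ k * a N) + (1 - r) * d"
      using Suc N[of "N + k"] r by (intro add_mono mult_left_mono) auto
    also have "\<dots> = d + r ^ Suc k * a N" by (simp add: algebra_simps)
    finally show ?case .
  qed
  have "(\<lambda>k. r ^ k * a N) \<longlonglongrightarrow> 0" using r by (intro tendsto_mult_left_zero LIMSEQ_realpow_zero) auto
  then obtain M where M: "\<And>k. k \<ge> M \<Longrightarrow> \<bar>r ^ k * a N\<bar> < d"
    using LIMSEQ_D[OF _ d] by fastforce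
  have "norm (a n - 0) < s" if "n \<ge> N + M" for n
  proof -
    have "M \<le> n - N" "N + (n - N) = n" using that by auto
    then have "a n < s" using step[of "n - N"] M[of "n - N"] by (simp add: d_def abs_less_iff)
    then show ?thesis using a by simp
  qed
  then show "\<exists>no. \<forall>n\<ge>no. norm (a n - 0) < s" by blast
qed

text \<open>\<open>kill_factors M [l\<^sub>1, \<dots>, l\<^sub>k] v\<close> is \<open>(M - l\<^sub>k) \<cdots> (M - l\<^sub>1) v\<close>. A list of roots instead of a polynomial
allows an induction that removes one linear factor at a time.\<close>

fun kill_factors :: "complex^'n^'n \<Rightarrow> complex list \<Rightarrow> complex^'n \<Rightarrow> complex^'n" where
  "kill_factors M [] v = v"
| "kill_factors M (l # ls) v = kill_factors M ls (M *v v - l *s v)"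

lemma kill_factors_commute:
  "M *v kill_factors M ls v - l *s kill_factors M ls v = kill_factors M ls (M *v v - l *s v)"
proof (induction ls arbitrary: v)
  case (Cons k ls)
  have "M *v (M *v v - k *s v) - l *s (M *v v - k *s v) = M *v (M *v v - l *s v) - k *s (M *v v - l *s v)"
    by (simp add: matrix_vector_mult_diff_distrib vec.scale algebra_simps
        vector_scalar_commute vec.scale_right_diff_distrib)
  then show ?case using Cons by simp
qed simp

text \<open>A factor \<open>M - l\<close> with \<open>\<bar>l\<bar> \<ge> 1\<close> is injective, because \<open>l\<close> is no eigenvalue, and can be cancelled. For
\<open>\<bar>l\<bar> < 1\<close> the sequence \<open>u\<^sub>k = M\<^sup>k v\<close> satisfies \<open>u\<^sub>k\<^sub>+\<^sub>1 = l u\<^sub>k + e\<^sub>k\<close>, where \<open>e\<^sub>k = M\<^sup>k (M v - l v)\<close> tends to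
zero by induction, so \<open>u\<close> tends to zero as well.\<close>

lemma powers_tendsto_0_if_annihilated:
  fixes M :: "complex^'n^'n"
  assumes stab: "\<And>l. mat_eigenvalue M l \<Longrightarrow> cmod l < 1"
    and "kill_factors M ls v = 0"
  shows "(\<lambda>k. (((*v) M) ^^ k) v) \<longlonglongrightarrow> 0"
  using assms(2)
proof (induction ls arbitrary: v)
  case Nil
  have "(((*v) M) ^^ k) 0 = 0" for k by (induction k) auto
  then show ?case using Nil by simp
next
  case (Cons l ls)
  show ?case
  proof (cases "cmod l < 1")
    case False
    have "M *v kill_factors M ls v = l *s kill_factors M ls v"
      using Cons.prems kill_factors_commute[of M ls v l] by simp
    then have "kill_factors M ls v = 0"
      using stab[of l] False unfolding mat_eigenvalue_def by blast
    then show ?thesis by (rule Cons.IH)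
  next
    case True
    let ?u = "\<lambda>k. (((*v) M) ^^ k) v" and ?e = "\<lambda>k. (((*v) M) ^^ k) (M *v v - l *s v)"
    have e: "?e k = ?u (Suc k) - l *s ?u k" for k
      by (induction k) (simp_all add: matrix_vector_mult_diff_distrib vector_scalar_commute)
    have nrm: "norm (c *s x) = cmod c * norm x" for c and x :: "complex^'n"
      by (simp add: norm_vec_def L2_set_def norm_mult power_mult_distrib real_sqrt_mult
          flip: sum_distrib_left)
    have rec: "norm (?u (Suc k)) \<le> cmod l * norm (?u k) + norm (?e k)" for k
      using norm_triangle_ineq[of "l *s ?u k" "?e k"] by (simp only: e nrm) simp
    have "kill_factors M ls (M *v v - l *s v) = 0" using Cons.prems by simp
    then have "(\<lambda>k. norm (?e k)) \<longlonglongrightarrow> 0" by (intro tendsto_norm_zero Cons.IH)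
    then have "(\<lambda>k. norm (?u k)) \<longlonglongrightarrow> 0"
      by (rule contracting_recursion_tendsto_0[where a = "\<lambda>k. norm (?u k)", OF norm_ge_zero True norm_ge_zero rec])
    then show ?thesis by (rule tendsto_norm_zero_cancel)
  qed
qed

text \<open>The fundamental theorem of algebra splits off linear factors of an annihilating polynomial.\<close>

lemma kill_factors_of_poly:
  fixes M :: "complex^'n^'n"
  assumes "p \<noteq> 0" "degree p < n" "(\<Sum>i<n. coeff p i *s (((*v) M) ^^ i) v) = 0"
  shows "\<exists>ls. kill_factors M ls v = 0"
  using assms
proof (induction n arbitrary: p v)
  case (Suc n)
  let ?f = "(*v) M"
  show ?case
  proof (cases "degree p = 0")
    case True
    then have c: "coeff p i = 0" if "i \<noteq> 0" for i using that by (simp add: coeff_eq_0)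
    have "(\<Sum>i<Suc n. coeff p i *s (?f ^^ i) v) = (\<Sum>i<Suc n. if i = 0 then coeff p 0 *s v else 0)"
      by (intro sum.cong refl) (auto simp: c)
    then have "coeff p 0 *s v = 0" using Suc.prems(3) by (simp del: sum.lessThan_Suc)
    moreover have "coeff p 0 \<noteq> 0" using True Suc.prems(1) by (metis leading_coeff_0_iff)
    ultimately have "kill_factors M [] v = 0" by (simp add: vec.scale_eq_0_iff)
    then show ?thesis by blast
  next
    case False
    then obtain z where "poly p z = 0"
      using fundamental_theorem_of_algebra[of p] by (auto simp: constant_degree)
    then obtain q where q: "p = [:-z, 1:] * q" by (auto simp: poly_eq_0_iff_dvd)
    have q0: "q \<noteq> 0" using Suc.prems(1) q by auto
    have deg: "degree p = Suc (degree q)" unfolding q using q0 by (subst degree_mult_eq) auto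
    have qn: "coeff q n = 0" using deg Suc.prems(2) by (intro coeff_eq_0) auto
    have "(\<Sum>i<n. coeff q i *s (?f ^^ i) (M *v v - z *s v))
        = (\<Sum>i<n. coeff q i *s (?f ^^ Suc i) v) - (\<Sum>i<n. (z * coeff q i) *s (?f ^^ i) v)"
    proof -
      have "(?f ^^ i) (M *v v - z *s v) = (?f ^^ Suc i) v - z *s (?f ^^ i) v" for i
        by (induction i) (simp_all add: matrix_vector_mult_diff_distrib vector_scalar_commute)
      then show ?thesis
        by (simp add: vec.scale_right_diff_distrib sum_subtractf mult.commute vector_smult_assoc)
    qed
    also have "(\<Sum>i<n. coeff q i *s (?f ^^ Suc i) v)
        = (\<Sum>i<Suc n. (case i of 0 \<Rightarrow> 0 | Suc j \<Rightarrow> coeff q j) *s (?f ^^ i) v)"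
      by (subst sum.lessThan_Suc_shift) simp
    also have "(\<Sum>i<n. (z * coeff q i) *s (?f ^^ i) v) = (\<Sum>i<Suc n. (z * coeff q i) *s (?f ^^ i) v)"
      by (simp add: qn)
    also have "(\<Sum>i<Suc n. (case i of 0 \<Rightarrow> 0 | Suc j \<Rightarrow> coeff q j) *s (?f ^^ i) v) - \<dots>
        = (\<Sum>i<Suc n. coeff p i *s (?f ^^ i) v)"
      unfolding q sum_subtractf[symmetric] vec.scale_left_diff_distrib[symmetric]
      by (intro sum.cong refl arg_cong2[where f = "(*s)"]) (auto simp: coeff_pCons split: nat.splits)
    finally have "(\<Sum>i<n. coeff q i *s (?f ^^ i) (M *v v - z *s v)) = 0" using Suc.prems(3) by simp
    then obtain ls where "kill_factors M ls (M *v v - z *s v) = 0"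
      using Suc.IH[OF q0] deg Suc.prems(2) by fastforce
    then have "kill_factors M (z # ls) v = 0" by simp
    then show ?thesis by blast
  qed
qed simp

text \<open>More vectors \<open>M\<^sup>i v\<close> than the dimension are linearly dependent; a dependence is an annihilating
polynomial.\<close>

lemma powers_annihilated:
  fixes M :: "complex^'n^'n"
  shows "\<exists>ls. kill_factors M ls v = 0"
proof -
  let ?f = "(*v) M"
  let ?n = "Suc DIM(complex^'n)"
  have "\<exists>p. p \<noteq> 0 \<and> degree p < ?n \<and> (\<Sum>i<?n. coeff p i *s (?f ^^ i) v) = 0"
  proof (cases "inj_on (\<lambda>i. (?f ^^ i) v) {..<?n}")
    case False
    then obtain i j where ij: "i < ?n" "j < ?n" "i \<noteq> j" "(?f ^^ i) v = (?f ^^ j) v"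
      by (auto simp: inj_on_def)
    define p where "p = monom (1::complex) i - monom 1 j"
    have cp: "coeff p k = (if k = i then 1 else 0) - (if k = j then 1 else 0)" for k
      by (simp add: p_def)
    have "coeff p i \<noteq> 0" using ij by (simp add: cp)
    then have "p \<noteq> 0" by auto
    moreover have "degree p < ?n"
      unfolding p_def using ij(1,2) degree_monom_eq[of "1::complex"]
      by (intro degree_diff_less) auto
    moreover have "(\<Sum>k<?n. coeff p k *s (?f ^^ k) v)
        = (\<Sum>k<?n. (if k = i then (?f ^^ i) v else 0)) - (\<Sum>k<?n. (if k = j then (?f ^^ j) v else 0))"
      unfolding sum_subtractf[symmetric] by (intro sum.cong) (auto simp: cp)
    then have "(\<Sum>k<?n. coeff p k *s (?f ^^ k) v) = 0" using ij by (simp del: sum.lessThan_Suc)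
    ultimately show ?thesis by blast
  next
    case True
    \<comment> \<open>\<^const>\<open>dependent\<close> speaks of sets, so coinciding vectors are treated separately above.\<close>
    define W where "W = (\<lambda>i. (?f ^^ i) v) ` {..<?n}"
    have "card W = ?n" using True by (simp add: W_def card_image)
    then have "dependent W"
      using independent_bound[of W] by fastforce
    moreover have "finite W" by (simp add: W_def)
    ultimately obtain u x where u: "x \<in> W" "u x \<noteq> 0" "(\<Sum>x\<in>W. u x *\<^sub>R x) = 0"
      using real_vector.dependent_finite[of W] by metis
    have s0: "(\<Sum>i<?n. u ((?f ^^ i) v) *\<^sub>R (?f ^^ i) v) = 0"
      using u(3) unfolding W_def by (subst (asm) sum.reindex[OF True]) simp
    define p where "p = (\<Sum>i<?n. monom (complex_of_real (u ((?f ^^ i) v))) i)"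
    have cp: "coeff p k = complex_of_real (u ((?f ^^ k) v))" if "k < ?n" for k
      unfolding p_def coeff_sum using that by (simp add: sum.delta del: sum.lessThan_Suc)
    obtain i where i: "i < ?n" "x = (?f ^^ i) v" using u(1) by (auto simp: W_def)
    have "coeff p i \<noteq> 0" using i u(2) by (simp add: cp)
    then have "p \<noteq> 0" by auto
    moreover have "degree p < ?n"
      unfolding p_def
      by (rule degree_lessI) (auto simp: coeff_sum coeff_monom intro!: sum.neutral)
    moreover have "(\<Sum>k<?n. coeff p k *s (?f ^^ k) v) = (\<Sum>k<?n. u ((?f ^^ k) v) *\<^sub>R (?f ^^ k) v)"
      by (intro sum.cong refl) (simp add: cp vec_eq_iff scaleR_conv_of_real[where 'a=complex])
    then have "(\<Sum>k<?n. coeff p k *s (?f ^^ k) v) = 0" using s0 by (simp only:)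
    ultimately show ?thesis by (intro exI[of _ p] conjI)
  qed
  then obtain p where "p \<noteq> 0" "degree p < ?n" "(\<Sum>i<?n. coeff p i *s (?f ^^ i) v) = 0" by blast
  then show ?thesis by (rule kill_factors_of_poly)
qed

lemma schur_stable_powers_tendsto_0:
  fixes F :: "real^'n^'n"
  assumes "schur_stable F"
  shows "(\<lambda>k. (((*v) F) ^^ k) x) \<longlonglongrightarrow> 0"
proof -
  let ?M = "complex_matrix F"
  obtain v where v: "re_vec v = x" using complex_vec_of_parts by blast
  obtain ls where "kill_factors ?M ls v = 0" using powers_annihilated by blast
  then have lim: "(\<lambda>k. (((*v) ?M) ^^ k) v) \<longlonglongrightarrow> 0"
    using assms by (intro powers_tendsto_0_if_annihilated) (auto simp: schur_stable_def)
  have re: "re_vec ((((*v) ?M) ^^ k) v) = (((*v) F) ^^ k) x" for k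
    by (induction k) (simp_all add: v re_im_vec_simps)
  have "norm ((((*v) F) ^^ k) x) \<le> norm ((((*v) ?M) ^^ k) v)" for k
    unfolding re[symmetric] by (rule power2_le_imp_le) (simp_all add: norm_complex_vec)
  then show ?thesis
    by (intro Lim_null_comparison[OF _ tendsto_norm_zero[OF lim]]) auto
qed

section \<open>From frequency response to energy balance\<close>

lemma sum_cos_roots_of_unity:
  fixes k l N :: nat
  assumes "k < N" "l < N"
  shows "(\<Sum>m<N. cos (2 * pi * real m / real N * (real k - real l))) = (if k = l then real N else 0)"
proof (cases "k = l")
  case False
  have N: "real N > 0" using assms by simp
  define z where "z = cis (2 * pi * (real k - real l) / real N)"
  have "z \<noteq> 1"
  proof
    assume "z = 1"
    then have "cos (2 * pi * (real k - real l) / real N) = 1"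
      by (metis cis.simps(1) one_complex.simps(1) z_def)
    then obtain n :: int where "2 * pi * (real k - real l) / real N = of_int n * 2 * pi"
      using cos_one_2pi_int by blast
    then have "2 * pi * (real k - real l) = 2 * pi * (of_int n * real N)"
      using N by (simp add: divide_eq_eq mult_ac)
    then have "real k - real l = of_int n * real N" using mult_left_cancel[of "2 * pi"] by simp
    then have "of_int (int k - int l) = (of_int (n * int N) :: real)" by simp
    then have eq: "int k - int l = n * int N" unfolding of_int_eq_iff .
    moreover have "\<bar>int k - int l\<bar> < int N" using assms by linarith
    ultimately have "\<bar>n\<bar> * int N < 1 * int N" by (simp add: abs_mult)
    then have "\<bar>n\<bar> < 1" using mult_less_cancel_right_disj[of "\<bar>n\<bar>" "int N" 1] by linarith
    then show False using eq False by simp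
  qed
  have "z ^ N = cis (2 * pi * (real k - real l))"
    unfolding z_def Complex.DeMoivre using N by simp
  also have "\<dots> = 1" by (rule cis_multiple_2pi) simp
  finally have "(\<Sum>m<N. z ^ m) = 0" using \<open>z \<noteq> 1\<close> by (simp add: geometric_sum)
  then have "(\<Sum>m<N. Re (z ^ m)) = 0" by (metis Re_sum zero_complex.simps(1))
  moreover have "Re (z ^ m) = cos (2 * pi * real m / real N * (real k - real l))" for m
    unfolding z_def Complex.DeMoivre by (simp add: mult_ac)
  ultimately show ?thesis using False by simp
qed simp

text \<open>Expanding the squared norms leaves \<open>y k \<bullet> y l\<close> weighted by \<open>\<Sum> cos (\<omega> (k - l))\<close> over the \<open>N\<close>
frequencies, which vanishes off the diagonal.\<close>

lemma discrete_parseval: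
  fixes y :: "nat \<Rightarrow> 'a::real_inner"
  defines "\<omega> \<equiv> \<lambda>N m. 2 * pi * real m / real N"
  shows "(\<Sum>m<N. (norm (\<Sum>k<N. cos (\<omega> N m * real k) *\<^sub>R y k))\<^sup>2
      + (norm (\<Sum>k<N. sin (\<omega> N m * real k) *\<^sub>R y k))\<^sup>2) = real N * (\<Sum>k<N. (norm (y k))\<^sup>2)"
proof -
  have sq: "(norm (\<Sum>k<N. c k *\<^sub>R y k))\<^sup>2 = (\<Sum>k<N. \<Sum>l<N. c k * c l * (y l \<bullet> y k))" for c
    by (simp add: power2_norm_eq_inner inner_sum_left inner_sum_right sum_distrib_left mult_ac)
  have "(\<Sum>m<N. (norm (\<Sum>k<N. cos (\<omega> N m * real k) *\<^sub>R y k))\<^sup>2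
      + (norm (\<Sum>k<N. sin (\<omega> N m * real k) *\<^sub>R y k))\<^sup>2)
    = (\<Sum>m<N. \<Sum>k<N. \<Sum>l<N. cos (\<omega> N m * (real k - real l)) * (y l \<bullet> y k))"
    unfolding sq sum.distrib[symmetric] right_diff_distrib cos_diff
    by (simp add: algebra_simps)
  also have "\<dots> = (\<Sum>k<N. \<Sum>m<N. \<Sum>l<N. cos (\<omega> N m * (real k - real l)) * (y l \<bullet> y k))"
    by (rule sum.swap)
  also have "\<dots> = (\<Sum>k<N. \<Sum>l<N. (\<Sum>m<N. cos (\<omega> N m * (real k - real l))) * (y l \<bullet> y k))"
    by (subst sum.swap) (simp add: sum_distrib_right)
  also have "\<dots> = (\<Sum>k<N. \<Sum>l<N. if l = k then real N * (y k \<bullet> y k) else 0)"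
    unfolding \<omega>_def by (intro sum.cong refl) (subst sum_cos_roots_of_unity, auto)
  also have "\<dots> = real N * (\<Sum>k<N. (norm (y k))\<^sup>2)"
    by (simp add: sum_distrib_left power2_norm_eq_inner)
  finally show ?thesis .
qed

text \<open>A run that starts and ends at rest is one period of an \<open>N\<close>-periodic run, so its discrete Fourier
coefficients are exact harmonic responses at the frequencies \<open>2 \<pi> m / N\<close>. Parseval's identity then
adds up the gain bounds at these frequencies; finitely many suffice, and no limit or integral
occurs.\<close>

lemma loop_energy_bound:
  fixes F :: "real^'x^'x" and G :: "real^'w^'x" and E :: "real^'x^'z"
  assumes gain: "\<And>\<omega> a b p q. \<omega> \<in> {0..2*pi} \<Longrightarrow> harmonic F G \<omega> a b p q \<Longrightarrow>
      (norm (E *v a))\<^sup>2 + (norm (E *v b))\<^sup>2 \<le> g * ((norm p)\<^sup>2 + (norm q)\<^sup>2)"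
    and rec: "\<And>k. k < N \<Longrightarrow> x (Suc k) = F *v x k + G *v w k"
    and ends: "x 0 = 0" "x N = 0"
  shows "(\<Sum>k<N. (norm (E *v x k))\<^sup>2) \<le> g * (\<Sum>k<N. (norm (w k))\<^sup>2)"
proof (cases "N = 0")
  case False
  then have N: "0 < real N" by simp
  define \<omega> where "\<omega> m = 2 * pi * real m / real N" for m
  let ?c = "\<lambda>m k. cos (\<omega> m * real k)" and ?s = "\<lambda>m k. sin (\<omega> m * real k)"
  let ?a = "\<lambda>m. \<Sum>k<N. ?c m k *\<^sub>R x k" and ?b = "\<lambda>m. - (\<Sum>k<N. ?s m k *\<^sub>R x k)"
  let ?p = "\<lambda>m. \<Sum>k<N. ?c m k *\<^sub>R w k" and ?q = "\<lambda>m. - (\<Sum>k<N. ?s m k *\<^sub>R w k)"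
  have shift: "(\<Sum>k<N. h (Suc k) *\<^sub>R x (Suc k)) = (\<Sum>k<N. h k *\<^sub>R x k)" for h :: "nat \<Rightarrow> real"
    using sum.lessThan_Suc_shift[of "\<lambda>k. h k *\<^sub>R x k" N] ends by simp
  have lin: "F *v (\<Sum>k<N. h k *\<^sub>R x k) + G *v (\<Sum>k<N. h k *\<^sub>R w k) = (\<Sum>k<N. h k *\<^sub>R x (Suc k))"
    for h :: "nat \<Rightarrow> real"
    by (simp add: linear_sum[OF matrix_vector_mul_linear] matrix_vector_mult_scaleR rec
        scaleR_add_right flip: sum.distrib)
  have harm: "harmonic F G (\<omega> m) (?a m) (?b m) (?p m) (?q m)" for m
    unfolding harmonic_def
  proof
    have "F *v ?a m + G *v ?p m = (\<Sum>k<N. cos (\<omega> m * (real (Suc k) - 1)) *\<^sub>R x (Suc k))"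
      unfolding lin by simp
    also have "\<dots> = (\<Sum>k<N. cos (\<omega> m * (real k - 1)) *\<^sub>R x k)" by (rule shift)
    also have "\<dots> = cos (\<omega> m) *\<^sub>R ?a m - sin (\<omega> m) *\<^sub>R ?b m"
      unfolding right_diff_distrib cos_diff
      by (simp add: scaleR_sum_right scaleR_add_left mult_ac flip: sum.distrib)
    finally show "F *v ?a m + G *v ?p m = cos (\<omega> m) *\<^sub>R ?a m - sin (\<omega> m) *\<^sub>R ?b m" .
    have "F *v ?b m + G *v ?q m = - (\<Sum>k<N. ?s m k *\<^sub>R x (Suc k))"
      unfolding lin[symmetric] by (simp add: linear_neg[OF matrix_vector_mul_linear])
    also have "\<dots> = - (\<Sum>k<N. sin (\<omega> m * (real (Suc k) - 1)) *\<^sub>R x (Suc k))" by simp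
    also have "\<dots> = - (\<Sum>k<N. sin (\<omega> m * (real k - 1)) *\<^sub>R x k)" by (subst shift) (rule refl)
    also have "\<dots> = sin (\<omega> m) *\<^sub>R ?a m + cos (\<omega> m) *\<^sub>R ?b m"
      unfolding right_diff_distrib sin_diff
      by (simp add: scaleR_sum_right scaleR_diff_left sum_subtractf mult_ac)
    finally show "F *v ?b m + G *v ?q m = sin (\<omega> m) *\<^sub>R ?a m + cos (\<omega> m) *\<^sub>R ?b m" .
  qed
  have Ex: "E *v (\<Sum>k<N. h k *\<^sub>R x k) = (\<Sum>k<N. h k *\<^sub>R (E *v x k))" for h :: "nat \<Rightarrow> real"
    by (simp add: linear_sum[OF matrix_vector_mul_linear] matrix_vector_mult_scaleR)
  have parseval: "(\<Sum>m<N. (norm (\<Sum>k<N. ?c m k *\<^sub>R y k))\<^sup>2 + (norm (\<Sum>k<N. ?s m k *\<^sub>R y k))\<^sup>2)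
      = real N * (\<Sum>k<N. (norm (y k))\<^sup>2)" for y :: "nat \<Rightarrow> 'v::real_inner"
    unfolding \<omega>_def by (rule discrete_parseval)
  have "real N * (\<Sum>k<N. (norm (E *v x k))\<^sup>2)
      = (\<Sum>m<N. (norm (E *v ?a m))\<^sup>2 + (norm (E *v ?b m))\<^sup>2)"
    by (simp only: Ex linear_neg[OF matrix_vector_mul_linear] norm_minus_cancel parseval)
  also have "\<dots> \<le> (\<Sum>m<N. g * ((norm (?p m))\<^sup>2 + (norm (?q m))\<^sup>2))"
  proof (rule sum_mono)
    fix m assume "m \<in> {..<N}"
    then have "\<omega> m \<in> {0..2*pi}" using N by (simp add: \<omega>_def divide_le_eq)
    then show "(norm (E *v ?a m))\<^sup>2 + (norm (E *v ?b m))\<^sup>2 \<le> g * ((norm (?p m))\<^sup>2 + (norm (?q m))\<^sup>2)"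
      using gain harm by blast
  qed
  also have "\<dots> = real N * (g * (\<Sum>k<N. (norm (w k))\<^sup>2))"
    by (simp only: norm_minus_cancel parseval sum_distrib_left[symmetric] mult.left_commute)
  finally show ?thesis using N by simp
qed simp

section \<open>The available storage of a closed loop\<close>

text \<open>The theorem of Jordan and von Neumann. The polarisation \<open>b\<close> of \<open>V\<close> is biadditive by the
parallelogram law; nonnegativity of \<open>V\<close> replaces the usual continuity hypothesis in the proof that
\<open>b\<close> is homogeneous.\<close>

lemma parallelogram_law_imp_quadratic_form:
  fixes V :: "real^'n \<Rightarrow> real"
  assumes nonneg: "\<And>x. 0 \<le> V x" and scale: "\<And>c x. V (c *\<^sub>R x) = c\<^sup>2 * V x"
    and par: "\<And>x y. V (x + y) + V (x - y) = 2 * V x + 2 * V y"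
  obtains P :: "real^'n^'n" where "symmetric_mat P" "\<And>x. x \<bullet> (P *v x) = V x"
proof -
  define b where "b x y = (V (x + y) - V (x - y)) / 4" for x y
  have V0: "V 0 = 0" using scale[of 0 0] by simp
  have Vm: "V (x - y) = V (y - x)" for x y using scale[of "-1" "x - y"] by simp
  have sym: "b x y = b y x" for x y by (simp add: b_def add.commute Vm)
  have bxx: "b x x = V x" for x using scale[of 2 x] by (simp add: b_def V0 scaleR_2)
  have b0: "b 0 z = 0" for z using Vm[of 0 z] by (simp add: b_def)
  have half: "b x z + b y z = b (x + y) (2 *\<^sub>R z) / 2" for x y z
  proof -
    have "x + z + (y + z) = x + y + 2 *\<^sub>R z" "x - z + (y - z) = x + y - 2 *\<^sub>R z"
      "x + z - (y + z) = x - y" "x - z - (y - z) = x - y"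
      by (simp_all add: scaleR_2)
    with par[of "x + z" "y + z"] par[of "x - z" "y - z"] show ?thesis
      unfolding b_def by (simp only:) argo
  qed
  have addl: "b (x + y) z = b x z + b y z" for x y z
    using half[of x z y] half[of "x + y" z 0] b0[of z] by simp
  have expand: "V (x + y) = V x + 2 * b x y + V y" for x y
    using addl[of x y "x + y"] addl[of x y x] addl[of x y y] sym[of x "x + y"] sym[of y "x + y"]
      sym[of y x] bxx[of "x + y"] bxx[of x] bxx[of y] by linarith
  \<comment> \<open>Additivity gives homogeneity over the integers; nonnegativity of \<open>V\<close> bounds the
    defect from below on \<open>[0, 1]\<close>, hence everywhere, and an additive bounded function is zero.\<close>
  have homl: "b (t *\<^sub>R x) y = t * b x y" for t x y
  proof -
    define h where "h t = b (t *\<^sub>R x) y - t * b x y" for t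
    have hadd: "h (s + t) = h s + h t" for s t
      by (simp add: h_def scaleR_add_left addl algebra_simps)
    have h0: "h 0 = 0" by (simp add: h_def b0)
    have h1: "h 1 = 0" by (simp add: h_def)
    have hneg: "h (- t) = - h t" for t using hadd[of t "- t"] h0 by simp
    have hnat: "h (real n * t) = real n * h t" for n t
      by (induction n) (simp_all add: h0 hadd algebra_simps)
    have hint: "h (of_int n) = 0" for n
    proof (cases "0 \<le> n")
      case True
      then show ?thesis using hnat[of "nat n" 1] h1 by simp
    next
      case False
      then show ?thesis using hnat[of "nat (- n)" 1] h1 hneg[of "of_int n"] by simp
    qed
    define C where "C = V x + V y + \<bar>b x y\<bar>"
    have lower: "- C \<le> h t" for t
    proof -
      define s where "s = t - of_int \<lfloor>t\<rfloor>"
      have s: "0 \<le> s" "s \<le> 1" unfolding s_def by linarith+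
      have "h t = h s" using hadd[of s "of_int \<lfloor>t\<rfloor>"] hint by (simp add: s_def)
      have "0 \<le> s\<^sup>2 * V x + 2 * b (s *\<^sub>R x) y + V y"
        using nonneg[of "s *\<^sub>R x + y"] by (simp add: expand scale)
      moreover have "s\<^sup>2 * V x \<le> V x"
        using s nonneg[of x] by (intro mult_left_le_one_le) (auto simp: power_le_one)
      moreover have "s * b x y \<le> \<bar>b x y\<bar>"
        using s by (smt (verit) mult_left_le_one_le mult_nonneg_nonpos)
      ultimately have "- C \<le> h s" using nonneg[of x] nonneg[of y] by (simp add: h_def C_def)
      then show ?thesis using \<open>h t = h s\<close> by simp
    qed
    have bound: "\<bar>h t\<bar> \<le> C" for t using lower[of t] lower[of "- t"] hneg[of t] by linarith
    have "h t = 0"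
    proof (rule ccontr)
      assume "h t \<noteq> 0"
      then obtain n where "C < real n * \<bar>h t\<bar>" using reals_Archimedean3 by (metis zero_less_abs_iff)
      then show False using bound[of "real n * t"] by (simp add: hnat abs_mult)
    qed
    then show ?thesis by (simp add: h_def)
  qed
  have linl: "linear (\<lambda>x. b x y)" for y by (rule linearI) (simp_all add: addl homl)
  have linr: "linear (b x)" for x unfolding sym[of x] by (rule linl)
  define P where "P = matrix (\<lambda>y. \<chi> i. b y (axis i 1))"
  have linP: "linear (\<lambda>y. \<chi> i. b y (axis i 1))"
    by (rule linearI) (simp_all add: vec_eq_iff addl homl)
  have form: "x \<bullet> (P *v y) = b y x" for x y
  proof -
    have "x \<bullet> (P *v y) = (\<Sum>i\<in>UNIV. x $ i * b y (axis i 1))"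
      unfolding P_def by (simp add: matrix_works linP inner_vec_def)
    also have "\<dots> = b y (\<Sum>i\<in>UNIV. x $ i *\<^sub>R axis i 1)"
      by (simp add: linear_sum[OF linr] linear_scale[OF linr])
    also have "(\<Sum>i\<in>UNIV. x $ i *\<^sub>R axis i 1) = x"
      using basis_expansion[of x] by (simp add: scalar_mult_eq_scaleR)
    finally show ?thesis .
  qed
  show ?thesis
  proof
    show "symmetric_mat P" by (rule symmetric_matI) (metis form inner_commute sym)
    show "x \<bullet> (P *v x) = V x" for x by (simp add: form bxx)
  qed
qed

text \<open>The form of \<open>P\<close> is a stored energy that never grows by more than the supply
\<open>g \<parallel>w\<parallel>\<^sup>2 - \<parallel>E x\<parallel>\<^sup>2\<close>.\<close>

definition dissipates :: "real^'x^'x \<Rightarrow> real^'w^'x \<Rightarrow> real^'x^'z \<Rightarrow> real \<Rightarrow> real^'x^'x \<Rightarrow> bool" where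
  "dissipates F G E g P \<longleftrightarrow> (\<forall>x w.
     (norm (E *v x))\<^sup>2 - g * (norm w)\<^sup>2 + (F *v x + G *v w) \<bullet> (P *v (F *v x + G *v w)) \<le> x \<bullet> (P *v x))"

definition finite_run ::
    "real^'x^'x \<Rightarrow> real^'w^'x \<Rightarrow> (nat \<Rightarrow> real^'x) \<Rightarrow> (nat \<Rightarrow> real^'w) \<Rightarrow> bool" where
  "finite_run F G x w \<longleftrightarrow>
     (\<forall>k. x (Suc k) = F *v x k + G *v w k) \<and> (\<exists>N. \<forall>k\<ge>N. x k = 0 \<and> w k = 0)"

definition payoff :: "real^'x^'z \<Rightarrow> real \<Rightarrow> (nat \<Rightarrow> real^'x) \<Rightarrow> (nat \<Rightarrow> real^'w) \<Rightarrow> real" where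
  "payoff E g x w = (\<Sum>k. (norm (E *v x k))\<^sup>2 - g * (norm (w k))\<^sup>2)"

lemma payoff_sums:
  assumes "finite_run F G x w"
  shows "(\<lambda>k. (norm (E *v x k))\<^sup>2 - g * (norm (w k))\<^sup>2) sums payoff E g x w"
proof -
  obtain N where "\<forall>k\<ge>N. x k = 0 \<and> w k = 0" using assms by (auto simp: finite_run_def)
  then have "summable (\<lambda>k. (norm (E *v x k))\<^sup>2 - g * (norm (w k))\<^sup>2)"
    by (intro summable_finite[of "{..<N}"]) auto
  then show ?thesis unfolding payoff_def by (rule summable_sums)
qed

text \<open>The dynamic programming step. It yields the dissipation inequality and, with \<open>a = 0\<close>, turns any
run into one that starts at rest.\<close>

lemma finite_run_prepend:
  assumes run: "finite_run F G x w" and x0: "x 0 = F *v a + G *v u"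
  shows "finite_run F G (case_nat a x) (case_nat u w)"
    and "payoff E g (case_nat a x) (case_nat u w) = (norm (E *v a))\<^sup>2 - g * (norm u)\<^sup>2 + payoff E g x w"
proof -
  show r: "finite_run F G (case_nat a x) (case_nat u w)"
    unfolding finite_run_def
  proof (intro conjI allI)
    fix k show "case_nat a x (Suc k) = F *v case_nat a x k + G *v case_nat u w k"
      using run x0 by (cases k) (auto simp: finite_run_def)
    obtain N where "\<forall>k\<ge>N. x k = 0 \<and> w k = 0" using run by (auto simp: finite_run_def)
    then show "\<exists>N. \<forall>k\<ge>N. case_nat a x k = 0 \<and> case_nat u w k = 0"
      by (intro exI[of _ "Suc N"]) (auto split: nat.split)
  qed
  have "(\<lambda>k. (norm (E *v case_nat a x (Suc k)))\<^sup>2 - g * (norm (case_nat u w (Suc k)))\<^sup>2) sums payoff E g x w"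
    using payoff_sums[OF run] by simp
  then have "(\<lambda>k. (norm (E *v case_nat a x k))\<^sup>2 - g * (norm (case_nat u w k))\<^sup>2) sums
      (payoff E g x w + ((norm (E *v case_nat a x 0))\<^sup>2 - g * (norm (case_nat u w 0))\<^sup>2))"
    by (rule sums_Suc)
  from sums_unique2[OF payoff_sums[OF r] this]
  show "payoff E g (case_nat a x) (case_nat u w) = (norm (E *v a))\<^sup>2 - g * (norm u)\<^sup>2 + payoff E g x w"
    by simp
qed

lemma finite_run_linear:
  assumes "finite_run F G x w" "finite_run F G x' w'"
  shows "finite_run F G (\<lambda>k. r *\<^sub>R x k + s *\<^sub>R x' k) (\<lambda>k. r *\<^sub>R w k + s *\<^sub>R w' k)"
proof -
  obtain N N' where "\<forall>k\<ge>N. x k = 0 \<and> w k = 0" "\<forall>k\<ge>N'. x' k = 0 \<and> w' k = 0"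
    using assms by (auto simp: finite_run_def)
  then have "\<forall>k\<ge>max N N'. r *\<^sub>R x k + s *\<^sub>R x' k = 0 \<and> r *\<^sub>R w k + s *\<^sub>R w' k = 0" by simp
  moreover have "r *\<^sub>R x (Suc k) + s *\<^sub>R x' (Suc k)
      = F *v (r *\<^sub>R x k + s *\<^sub>R x' k) + G *v (r *\<^sub>R w k + s *\<^sub>R w' k)" for k
    using assms
    by (simp add: finite_run_def matrix_vector_right_distrib matrix_vector_mult_scaleR scaleR_add_right)
  ultimately show ?thesis unfolding finite_run_def by blast
qed

lemma payoff_parallelogram:
  assumes "finite_run F G x w" "finite_run F G x' w'"
  shows "payoff E g (\<lambda>k. x k + x' k) (\<lambda>k. w k + w' k) + payoff E g (\<lambda>k. x k - x' k) (\<lambda>k. w k - w' k)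
    = 2 * payoff E g x w + 2 * payoff E g x' w'"
proof -
  have r: "finite_run F G (\<lambda>k. x k + x' k) (\<lambda>k. w k + w' k)"
      "finite_run F G (\<lambda>k. x k - x' k) (\<lambda>k. w k - w' k)"
    using finite_run_linear[OF assms, of 1 1] finite_run_linear[OF assms, of 1 "-1"] by simp_all
  have pn: "(norm (a + b))\<^sup>2 + (norm (a - b))\<^sup>2 = 2 * (norm a)\<^sup>2 + 2 * (norm b)\<^sup>2"
    for a b :: "'v::real_inner"
    by (simp add: power2_norm_eq_inner inner_add inner_diff inner_commute)
  have point: "(norm (E *v (x k + x' k)))\<^sup>2 - g * (norm (w k + w' k))\<^sup>2
      + ((norm (E *v (x k - x' k)))\<^sup>2 - g * (norm (w k - w' k))\<^sup>2)
      = 2 * ((norm (E *v x k))\<^sup>2 - g * (norm (w k))\<^sup>2) + 2 * ((norm (E *v x' k))\<^sup>2 - g * (norm (w' k))\<^sup>2)" for k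
    using pn[of "E *v x k" "E *v x' k"] arg_cong[OF pn[of "w k" "w' k"], of "(*) g"]
    by (simp add: matrix_vector_right_distrib matrix_vector_mult_diff_distrib algebra_simps)
  have "(\<lambda>k. 2 * ((norm (E *v x k))\<^sup>2 - g * (norm (w k))\<^sup>2) + 2 * ((norm (E *v x' k))\<^sup>2 - g * (norm (w' k))\<^sup>2))
      sums (2 * payoff E g x w + 2 * payoff E g x' w')"
    by (intro sums_add sums_mult payoff_sums[OF assms(1)] payoff_sums[OF assms(2)])
  from sums_unique2[OF sums_add[OF payoff_sums[OF r(1)] payoff_sums[OF r(2)], of E g E g, unfolded point] this]
  show ?thesis .
qed

lemma payoff_scale:
  assumes "finite_run F G x w"
  shows "payoff E g (\<lambda>k. c *\<^sub>R x k) (\<lambda>k. c *\<^sub>R w k) = c\<^sup>2 * payoff E g x w"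
proof -
  have r: "finite_run F G (\<lambda>k. c *\<^sub>R x k) (\<lambda>k. c *\<^sub>R w k)"
    using finite_run_linear[OF assms assms, of c 0] by simp
  have point: "c\<^sup>2 * ((norm (E *v x k))\<^sup>2 - g * (norm (w k))\<^sup>2)
      = (norm (E *v (c *\<^sub>R x k)))\<^sup>2 - g * (norm (c *\<^sub>R w k))\<^sup>2" for k
    by (simp add: matrix_vector_mult_scaleR power_mult_distrib algebra_simps)
  have "(\<lambda>k. c\<^sup>2 * ((norm (E *v x k))\<^sup>2 - g * (norm (w k))\<^sup>2)) sums (c\<^sup>2 * payoff E g x w)"
    by (intro sums_mult payoff_sums[OF assms])
  from sums_unique2[OF payoff_sums[OF r] this[unfolded point]] show ?thesis .
qed

text \<open>Let \<open>V a\<close> be the supremum of the payoff over the finite runs from \<open>a\<close>.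

\<^item> Because \<open>G\<close> is onto, an extra first step from \<open>0\<close> to \<open>a\<close> costs \<open>g \<parallel>G' a\<parallel>\<^sup>2\<close>. The prolonged run
  starts and ends at rest, so its payoff is at most zero; this is the upper bound.
\<^item> Coasting without input and steering to \<open>0\<close> after \<open>n\<close> steps costs little for large \<open>n\<close>, because
  the powers of \<open>F\<close> tend to zero; this is the lower bound.
\<^item> The payoff is a quadratic form on the linear space of runs. Adding and subtracting runs gives one
  half of the parallelogram law for \<open>V\<close>, and the same inequality applied to \<open>a + a'\<close> and \<open>a - a'\<close>
  gives the other half. Hence \<open>V\<close> is a quadratic form.\<close>

lemma available_storage_exists:
  fixes F :: "real^'x^'x" and G :: "real^'w^'x" and E :: "real^'x^'z" and G' :: "real^'x^'w"
  assumes stab: "schur_stable F" and G': "G ** G' = mat 1"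
    and gain: "\<And>\<omega> a b p q. \<omega> \<in> {0..2*pi} \<Longrightarrow> harmonic F G \<omega> a b p q \<Longrightarrow>
      (norm (E *v a))\<^sup>2 + (norm (E *v b))\<^sup>2 \<le> g * ((norm p)\<^sup>2 + (norm q)\<^sup>2)"
  obtains P where "symmetric_mat P" "dissipates F G E g P"
    "\<And>x. (norm (E *v x))\<^sup>2 \<le> x \<bullet> (P *v x)" "\<And>x. x \<bullet> (P *v x) \<le> g * (norm (G' *v x))\<^sup>2"
proof -
  have GG: "G *v (G' *v x) = x" for x by (simp add: matrix_vector_mul_assoc G')
  define S where "S a = {payoff E g x w | x w. finite_run F G x w \<and> x 0 = a}" for a
  define V where "V a = Sup (S a)" for a
  have upper: "c \<le> g * (norm (G' *v a))\<^sup>2" if c_mem: "c \<in> S a" for a c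
  proof -
    obtain x w where run: "finite_run F G x w" and x0: "x 0 = a" and c: "c = payoff E g x w"
      using c_mem unfolding S_def by blast
    let ?x = "case_nat 0 x" and ?w = "case_nat (G' *v a) w"
    have "x 0 = F *v 0 + G *v (G' *v a)" by (simp add: x0 GG)
    note pre = finite_run_prepend[OF run this]
    obtain N where N: "\<forall>k\<ge>N. ?x k = 0 \<and> ?w k = 0" using pre(1) by (auto simp: finite_run_def)
    have "(\<lambda>k. (norm (E *v ?x k))\<^sup>2 - g * (norm (?w k))\<^sup>2) sums
        (\<Sum>k<N. (norm (E *v ?x k))\<^sup>2 - g * (norm (?w k))\<^sup>2)"
      using N by (intro sums_finite) auto
    then have "payoff E g ?x ?w = (\<Sum>k<N. (norm (E *v ?x k))\<^sup>2 - g * (norm (?w k))\<^sup>2)"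
      using sums_unique2[OF payoff_sums[OF pre(1)]] by blast
    also have "\<dots> = (\<Sum>k<N. (norm (E *v ?x k))\<^sup>2) - g * (\<Sum>k<N. (norm (?w k))\<^sup>2)"
      by (simp add: sum_subtractf sum_distrib_left)
    also have "\<dots> \<le> 0"
      using loop_energy_bound[of F G E g N ?x ?w, OF gain] pre(1) N by (auto simp: finite_run_def)
    finally show ?thesis unfolding pre(2) c by simp
  qed
  have bdd: "bdd_above (S a)" for a using upper by (intro bdd_aboveI)
  have coast: "\<exists>c\<in>S a. (norm (E *v a))\<^sup>2 - g * (norm (G' *v (((*v) F) ^^ Suc n) a))\<^sup>2 \<le> c" for a n
  proof -
    let ?f = "(*v) F"
    define x where "x k = (if k \<le> n then (?f ^^ k) a else 0)" for k
    define w where "w k = (if k = n then - (G' *v (?f ^^ Suc n) a) else 0)" for k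
    have run: "finite_run F G x w"
      unfolding finite_run_def
    proof (intro conjI allI)
      fix k show "x (Suc k) = F *v x k + G *v w k"
        by (auto simp: x_def w_def GG linear_neg[OF matrix_vector_mul_linear])
      show "\<exists>N. \<forall>k\<ge>N. x k = 0 \<and> w k = 0"
        by (intro exI[of _ "Suc n"]) (auto simp: x_def w_def)
    qed
    have "payoff E g x w = (\<Sum>k<Suc n. (norm (E *v x k))\<^sup>2 - g * (norm (w k))\<^sup>2)"
      by (rule sums_unique2[OF payoff_sums[OF run]], rule sums_finite) (auto simp: x_def w_def)
    also have "\<dots> = (\<Sum>k<Suc n. (norm (E *v x k))\<^sup>2) - g * (\<Sum>k<Suc n. (norm (w k))\<^sup>2)"
      by (simp add: sum_subtractf sum_distrib_left del: sum.lessThan_Suc)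
    also have "(\<Sum>k<Suc n. (norm (w k))\<^sup>2) = (norm (w n))\<^sup>2"
      by (simp add: w_def)
    finally have "payoff E g x w = (\<Sum>k<Suc n. (norm (E *v x k))\<^sup>2) - g * (norm (w n))\<^sup>2" .
    moreover have "(norm (E *v x 0))\<^sup>2 \<le> (\<Sum>k<Suc n. (norm (E *v x k))\<^sup>2)"
      by (rule member_le_sum) auto
    ultimately have "(norm (E *v a))\<^sup>2 - g * (norm (G' *v (?f ^^ Suc n) a))\<^sup>2 \<le> payoff E g x w"
      by (simp add: x_def w_def)
    moreover have "x 0 = a" by (simp add: x_def)
    then have "payoff E g x w \<in> S a" using run unfolding S_def by blast
    ultimately show ?thesis by blast
  qed
  then have ne: "S a \<noteq> {}" for a by blast
  have le_V: "payoff E g x w \<le> V (x 0)" if "finite_run F G x w" for x w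
    unfolding V_def using that bdd by (intro cSup_upper) (auto simp: S_def)
  have V_le: "V a \<le> c" if "\<And>x w. finite_run F G x w \<Longrightarrow> x 0 = a \<Longrightarrow> payoff E g x w \<le> c" for a c
    unfolding V_def using that by (intro cSup_least[OF ne]) (auto simp: S_def)
  have V_upper: "V a \<le> g * (norm (G' *v a))\<^sup>2" for a
    unfolding V_def by (intro cSup_least[OF ne] upper)
  have V_lower: "(norm (E *v a))\<^sup>2 \<le> V a" for a
  proof (rule LIMSEQ_le_const2)
    have lim: "(\<lambda>n. (((*v) F) ^^ Suc n) a) \<longlonglongrightarrow> 0"
      by (rule LIMSEQ_Suc[OF schur_stable_powers_tendsto_0[OF stab]])
    have "(\<lambda>n. G' *v (((*v) F) ^^ Suc n) a) \<longlonglongrightarrow> G' *v 0"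
      using linear_continuous_at lim
      by (intro isCont_tendsto_compose[OF _ lim]) (simp add: linear_continuous_at matrix_vector_mul_bounded_linear)
    then have "(\<lambda>n. (norm (E *v a))\<^sup>2 - g * (norm (G' *v (((*v) F) ^^ Suc n) a))\<^sup>2)
        \<longlonglongrightarrow> (norm (E *v a))\<^sup>2 - g * (norm (G' *v 0))\<^sup>2"
      by (intro tendsto_intros)
    then show "(\<lambda>n. (norm (E *v a))\<^sup>2 - g * (norm (G' *v (((*v) F) ^^ Suc n) a))\<^sup>2) \<longlonglongrightarrow> (norm (E *v a))\<^sup>2"
      by simp
    have "(norm (E *v a))\<^sup>2 - g * (norm (G' *v (((*v) F) ^^ Suc n) a))\<^sup>2 \<le> V a" for n
      using coast[of a n] cSup_upper[OF _ bdd[of a]] unfolding V_def by (meson order_trans)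
    then show "\<exists>N. \<forall>n\<ge>N. (norm (E *v a))\<^sup>2 - g * (norm (G' *v (((*v) F) ^^ Suc n) a))\<^sup>2 \<le> V a"
      by blast
  qed
  have scale_le: "c\<^sup>2 * V a \<le> V (c *\<^sub>R a)" if "c \<noteq> 0" for c a
  proof -
    have "V a \<le> V (c *\<^sub>R a) / c\<^sup>2"
    proof (rule V_le)
      fix x w assume run: "finite_run F G x w" and x0: "x 0 = a"
      have "finite_run F G (\<lambda>k. c *\<^sub>R x k) (\<lambda>k. c *\<^sub>R w k)"
        using finite_run_linear[OF run run, of c 0] by simp
      from le_V[OF this] have "c\<^sup>2 * payoff E g x w \<le> V (c *\<^sub>R a)"
        by (simp add: payoff_scale[OF run] x0)
      then show "payoff E g x w \<le> V (c *\<^sub>R a) / c\<^sup>2" using that by (simp add: field_simps)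
    qed
    then show ?thesis using that by (simp add: field_simps)
  qed
  have scale: "V (c *\<^sub>R a) = c\<^sup>2 * V a" for c a
  proof (cases "c = 0")
    case True
    then show ?thesis using V_upper[of 0] V_lower[of 0] by simp
  next
    case False
    have "c\<^sup>2 * ((inverse c)\<^sup>2 * V (c *\<^sub>R a)) \<le> c\<^sup>2 * V a"
      using scale_le[of "inverse c" "c *\<^sub>R a"] False by (intro mult_left_mono) auto
    then have "V (c *\<^sub>R a) \<le> c\<^sup>2 * V a" using False by (simp add: field_simps)
    with scale_le[OF False] show ?thesis by (meson antisym)
  qed
  have par_le: "2 * V a + 2 * V a' \<le> V (a + a') + V (a - a')" for a a'
  proof -
    have "payoff E g x w \<le> (V (a + a') + V (a - a') - 2 * V a') / 2"
      if run: "finite_run F G x w" and x0: "x 0 = a" for x w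
    proof -
      have "V a' \<le> (V (a + a') + V (a - a') - 2 * payoff E g x w) / 2"
      proof (rule V_le)
        fix x' w' assume run': "finite_run F G x' w'" and x0': "x' 0 = a'"
        have r: "finite_run F G (\<lambda>k. x k + x' k) (\<lambda>k. w k + w' k)"
            "finite_run F G (\<lambda>k. x k - x' k) (\<lambda>k. w k - w' k)"
          using finite_run_linear[OF run run', of 1 1] finite_run_linear[OF run run', of 1 "-1"] by simp_all
        show "payoff E g x' w' \<le> (V (a + a') + V (a - a') - 2 * payoff E g x w) / 2"
          using le_V[OF r(1)] le_V[OF r(2)] payoff_parallelogram[OF run run', of E g] x0 x0' by simp
      qed
      then show ?thesis by simp
    qed
    then have "V a \<le> (V (a + a') + V (a - a') - 2 * V a') / 2" by (rule V_le)
    then show ?thesis by simp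
  qed
  have par: "V (a + a') + V (a - a') = 2 * V a + 2 * V a'" for a a'
  proof (rule antisym)
    have "2 * V (a + a') + 2 * V (a - a') \<le> V (2 *\<^sub>R a) + V (2 *\<^sub>R a')"
      using par_le[of "a + a'" "a - a'"] by (simp add: scaleR_2)
    then show "V (a + a') + V (a - a') \<le> 2 * V a + 2 * V a'" unfolding scale by simp
  qed (rule par_le)
  have V_nonneg: "0 \<le> V a" for a using V_lower[of a] by (meson order_trans zero_le_power2)
  obtain P where P: "symmetric_mat P" "\<And>x. x \<bullet> (P *v x) = V x"
    using parallelogram_law_imp_quadratic_form[OF V_nonneg scale par] by blast
  have "dissipates F G E g P"
    unfolding dissipates_def P(2)
  proof (intro allI)
    fix a u
    have "V (F *v a + G *v u) \<le> V a - ((norm (E *v a))\<^sup>2 - g * (norm u)\<^sup>2)"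
    proof (rule V_le)
      fix x w assume "finite_run F G x w" "x 0 = F *v a + G *v u"
      note pre = finite_run_prepend[OF this]
      show "payoff E g x w \<le> V a - ((norm (E *v a))\<^sup>2 - g * (norm u)\<^sup>2)"
        using le_V[OF pre(1)] by (simp add: pre(2))
    qed
    then show "(norm (E *v a))\<^sup>2 - g * (norm u)\<^sup>2 + V (F *v a + G *v u) \<le> V a" by simp
  qed
  then show ?thesis using that[OF P(1)] V_lower V_upper unfolding P(2) by blast
qed

section \<open>Storage certificates characterise the cost\<close>

lemma quadratic_form_rotate:
  fixes P :: "real^'n^'n"
  assumes "symmetric_mat P"
  shows "(c *\<^sub>R a - s *\<^sub>R b) \<bullet> (P *v (c *\<^sub>R a - s *\<^sub>R b)) + (s *\<^sub>R a + c *\<^sub>R b) \<bullet> (P *v (s *\<^sub>R a + c *\<^sub>R b))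
    = (c\<^sup>2 + s\<^sup>2) * (a \<bullet> (P *v a) + b \<bullet> (P *v b))"
  using symmetric_mat_inner[OF assms, of a b] inner_commute[of "P *v a" b]
  by (simp add: matrix_vector_right_distrib matrix_vector_mult_diff_distrib matrix_vector_mult_scaleR
      inner_add inner_diff power2_eq_square algebra_simps)

text \<open>The stored energy of a harmonic response, real and imaginary part together, is constant in time, so
its supply must be nonnegative.\<close>

lemma dissipates_imp_harmonic_gain:
  assumes sym: "symmetric_mat P" and diss: "dissipates F G E g P" and "harmonic F G \<omega> a b p q"
  shows "(norm (E *v a))\<^sup>2 + (norm (E *v b))\<^sup>2 \<le> g * ((norm p)\<^sup>2 + (norm q)\<^sup>2)"
proof -
  have resp: "F *v a + G *v p = cos \<omega> *\<^sub>R a - sin \<omega> *\<^sub>R b" "F *v b + G *v q = sin \<omega> *\<^sub>R a + cos \<omega> *\<^sub>R b"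
    using assms(3) by (auto simp: harmonic_def)
  have step: "(norm (E *v x))\<^sup>2 - g * (norm w)\<^sup>2 + (F *v x + G *v w) \<bullet> (P *v (F *v x + G *v w)) \<le> x \<bullet> (P *v x)" for x w
    using diss by (simp add: dissipates_def)
  have "(cos \<omega>)\<^sup>2 + (sin \<omega>)\<^sup>2 = 1" by simp
  from quadratic_form_rotate[OF sym, of "cos \<omega>" a "sin \<omega>" b, unfolded this mult_1]
    step[of a p, unfolded resp] step[of b q, unfolded resp]
  show ?thesis unfolding distrib_left by linarith
qed

text \<open>Without input, an eigenvector for \<open>l\<close> has its stored energy multiplied by \<open>\<bar>l\<bar>\<^sup>2\<close>, while dissipation
makes that energy strictly smaller.\<close>

lemma dissipates_imp_schur_stable:
  assumes sym: "symmetric_mat P" and pos: "\<And>x. x \<noteq> 0 \<Longrightarrow> 0 < x \<bullet> (P *v x)"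
    and obs: "\<And>x. x \<noteq> 0 \<Longrightarrow> E *v x \<noteq> 0" and diss: "dissipates F G E g P"
  shows "schur_stable F"
  unfolding schur_stable_def
proof (intro allI impI)
  fix l assume "mat_eigenvalue (complex_matrix F) l"
  then obtain v where v: "v \<noteq> 0" "complex_matrix F *v v = l *s v" by (auto simp: mat_eigenvalue_def)
  define a b where "a = re_vec v" and "b = im_vec v"
  have Fab: "F *v a = Re l *\<^sub>R a - Im l *\<^sub>R b" "F *v b = Im l *\<^sub>R a + Re l *\<^sub>R b"
    using v(2) unfolding complex_vec_eq_iff re_im_vec_simps a_def b_def by auto
  have ab: "a \<noteq> 0 \<or> b \<noteq> 0"
    using v(1) unfolding a_def b_def complex_vec_eq_iff by (auto simp: re_vec_def im_vec_def vec_eq_iff)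
  have step: "(norm (E *v x))\<^sup>2 + (F *v x) \<bullet> (P *v (F *v x)) \<le> x \<bullet> (P *v x)" for x
    using diss[unfolded dissipates_def, rule_format, of x 0] by simp
  let ?V = "a \<bullet> (P *v a) + b \<bullet> (P *v b)"
  have nonneg: "0 \<le> x \<bullet> (P *v x)" for x by (cases "x = 0") (auto simp: less_imp_le pos)
  have "0 < ?V" using ab pos nonneg[of a] nonneg[of b] by (metis add_nonneg_pos add_pos_nonneg)
  have "0 < (norm (E *v a))\<^sup>2 + (norm (E *v b))\<^sup>2"
    using ab obs by (metis add_nonneg_pos add_pos_nonneg zero_le_power2 zero_less_norm_iff zero_less_power)
  then have "((Re l)\<^sup>2 + (Im l)\<^sup>2) * ?V < ?V"
    using step[of a] step[of b] quadratic_form_rotate[OF sym, of "Re l" a "Im l" b]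
    unfolding Fab by linarith
  then have "(cmod l)\<^sup>2 < 1" using \<open>0 < ?V\<close> by (simp add: cmod_power2)
  then show "cmod l < 1" by (simp add: power_less_one_iff abs_square_less_1)
qed

lemma norm_stack_rows:
  fixes M :: "real^'n^'m" and N :: "real^'n^'k"
  shows "(norm (stack_rows M N *v x))\<^sup>2 = (norm (M *v x))\<^sup>2 + (norm (N *v x))\<^sup>2"
proof -
  have "(norm (stack_rows M N *v x))\<^sup>2 = (\<Sum>i\<in>UNIV <+> UNIV. ((stack_rows M N *v x) $ i)\<^sup>2)"
    unfolding UNIV_Plus_UNIV by (simp add: norm_vec_def L2_set_def sum_nonneg)
  also have "\<dots> = (\<Sum>i\<in>UNIV. ((M *v x) $ i)\<^sup>2) + (\<Sum>i\<in>UNIV. ((N *v x) $ i)\<^sup>2)"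
    by (subst sum.Plus) (simp_all add: stack_rows_def matrix_vector_mult_def)
  finally show ?thesis by (simp add: norm_vec_def L2_set_def sum_nonneg)
qed

definition stage_cost :: "real^'x^'x \<Rightarrow> real^'u^'u \<Rightarrow> real^'x^'u \<Rightarrow> real^'x \<Rightarrow> real" where
  "stage_cost Q R K x = x \<bullet> (Q *v x) + (K *v x) \<bullet> (R *v (K *v x))"

lemma norm_performance_output:
  assumes "pos_def Q" "pos_def R"
  shows "(norm (stack_rows (psd_sqrt Q) (psd_sqrt R ** K) *v x))\<^sup>2 = stage_cost Q R K x"
  using assms[THEN pos_def_imp_pos_semidef]
  by (simp add: norm_stack_rows norm_psd_sqrt stage_cost_def flip: matrix_vector_mul_assoc)

text \<open>The dissipation inequality of the closed loop, written with the stage cost instead of the output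
matrix, so that it depends on \<open>K\<close> and \<open>P\<close> continuously in an evident way.\<close>

definition certifies ::
    "real^'x^'x \<Rightarrow> real^'u^'x \<Rightarrow> real^'w^'x \<Rightarrow> real^'x^'x \<Rightarrow> real^'u^'u \<Rightarrow> real
      \<Rightarrow> real^'x^'u \<Rightarrow> real^'x^'x \<Rightarrow> bool" where
  "certifies A B G Q R g K P \<longleftrightarrow> pos_def P \<and>
     (\<forall>x w. stage_cost Q R K x - g * (norm w)\<^sup>2
        + (A *v x + B *v (K *v x) + G *v w) \<bullet> (P *v (A *v x + B *v (K *v x) + G *v w)) \<le> x \<bullet> (P *v x))"

lemma certifies_iff_dissipates:
  assumes "pos_def Q" "pos_def R"
  shows "certifies A B G Q R g K P \<longleftrightarrow>
    pos_def P \<and> dissipates (A + B ** K) G (stack_rows (psd_sqrt Q) (psd_sqrt R ** K)) g P"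
  by (simp add: certifies_def dissipates_def norm_performance_output[OF assms]
      matrix_vector_mult_add_rdistrib flip: matrix_vector_mul_assoc)

lemma T_zw_state_feedback:
  "T_zw A B G (mat 1) Q R K \<omega> = transfer (A + B ** K) G (stack_rows (psd_sqrt Q) (psd_sqrt R ** K)) \<omega>"
  by (simp add: T_zw_def transfer_def)

lemma hinf_cost_nonneg:
  assumes "K \<in> stabilizing_gains A B (mat 1)"
  shows "0 \<le> hinf_cost A B G (mat 1) Q R K"
proof -
  have "schur_stable (A + B ** K)" using assms by (simp add: stabilizing_gains_def)
  then have "sigma_max (T_zw A B G (mat 1) Q R K 0) \<le> hinf_cost A B G (mat 1) Q R K"
    unfolding hinf_cost_def T_zw_state_feedback
    by (intro cSUP_upper sigma_max_transfer_bounded) auto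
  then show ?thesis using sigma_max_nonneg order_trans by blast
qed

lemma hinf_cost_le_iff:
  assumes stab: "K \<in> stabilizing_gains A B (mat 1)" and c: "0 \<le> c"
  shows "hinf_cost A B G (mat 1) Q R K \<le> c \<longleftrightarrow>
    (\<forall>\<omega>\<in>{0..2*pi}. \<forall>a b p q. harmonic (A + B ** K) G \<omega> a b p q \<longrightarrow>
      (norm (stack_rows (psd_sqrt Q) (psd_sqrt R ** K) *v a))\<^sup>2
        + (norm (stack_rows (psd_sqrt Q) (psd_sqrt R ** K) *v b))\<^sup>2 \<le> c\<^sup>2 * ((norm p)\<^sup>2 + (norm q)\<^sup>2))"
proof -
  have F: "schur_stable (A + B ** K)" using stab by (simp add: stabilizing_gains_def)
  show ?thesis
    unfolding hinf_cost_def T_zw_state_feedback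
    by (subst cSUP_le_iff[OF _ sigma_max_transfer_bounded[OF F]])
      (simp_all add: sigma_max_transfer_le_iff[OF F c])
qed

text \<open>The easy half of the bounded real lemma. The certificate need not be the available storage, which
is what makes interpolated certificates useful.\<close>

lemma certificate_imp_cost_bound:
  assumes Q: "pos_def Q" and R: "pos_def R" and c: "0 \<le> c" and cert: "certifies A B G Q R (c\<^sup>2) K P"
  shows "K \<in> stabilizing_gains A B (mat 1)" and "hinf_cost A B G (mat 1) Q R K \<le> c"
proof -
  let ?E = "stack_rows (psd_sqrt Q) (psd_sqrt R ** K)"
  have P: "pos_def P" and diss: "dissipates (A + B ** K) G ?E (c\<^sup>2) P"
    using cert by (auto simp: certifies_iff_dissipates[OF Q R])
  have sym: "symmetric_mat P" and pos: "\<And>x. x \<noteq> 0 \<Longrightarrow> 0 < x \<bullet> (P *v x)"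
    using P by (auto simp: pos_def_def)
  have "?E *v x \<noteq> 0" if "x \<noteq> 0" for x
  proof -
    have "0 < x \<bullet> (Q *v x)" using Q that by (simp add: pos_def_def)
    moreover have "0 \<le> (K *v x) \<bullet> (R *v (K *v x))"
      using pos_def_imp_pos_semidef[OF R] by (simp add: pos_semidef_def)
    ultimately have "0 < (norm (?E *v x))\<^sup>2"
      unfolding norm_performance_output[OF Q R] stage_cost_def by simp
    then show ?thesis by auto
  qed
  from dissipates_imp_schur_stable[OF sym pos this diss]
  show K: "K \<in> stabilizing_gains A B (mat 1)" by (simp add: stabilizing_gains_def)
  show "hinf_cost A B G (mat 1) Q R K \<le> c"
    unfolding hinf_cost_le_iff[OF K c] using dissipates_imp_harmonic_gain[OF sym diss] by blast
qed

text \<open>The hard half of the bounded real lemma, at the exact level \<open>c\<close> and with bounds on \<open>P\<close> that hold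
uniformly over a sublevel set of the cost.\<close>

lemma cost_bound_imp_certificate:
  assumes Q: "pos_def Q" and R: "pos_def R" and G': "G ** G' = mat 1"
    and K: "K \<in> stabilizing_gains A B (mat 1)" and c: "hinf_cost A B G (mat 1) Q R K \<le> c"
  obtains P where "certifies A B G Q R (c\<^sup>2) K P"
    "\<And>x. stage_cost Q R K x \<le> x \<bullet> (P *v x)" "\<And>x. x \<bullet> (P *v x) \<le> c\<^sup>2 * (norm (G' *v x))\<^sup>2"
proof -
  let ?E = "stack_rows (psd_sqrt Q) (psd_sqrt R ** K)"
  have F: "schur_stable (A + B ** K)" using K by (simp add: stabilizing_gains_def)
  have "0 \<le> c" using hinf_cost_nonneg[OF K, of G Q R] c by simp
  from c[unfolded hinf_cost_le_iff[OF K this]]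
  have gain: "(norm (?E *v a))\<^sup>2 + (norm (?E *v b))\<^sup>2 \<le> c\<^sup>2 * ((norm p)\<^sup>2 + (norm q)\<^sup>2)"
    if "\<omega> \<in> {0..2*pi}" "harmonic (A + B ** K) G \<omega> a b p q" for \<omega> a b p q using that by blast
  obtain P where P: "symmetric_mat P" "dissipates (A + B ** K) G ?E (c\<^sup>2) P"
    "\<And>x. (norm (?E *v x))\<^sup>2 \<le> x \<bullet> (P *v x)" "\<And>x. x \<bullet> (P *v x) \<le> c\<^sup>2 * (norm (G' *v x))\<^sup>2"
    by (rule available_storage_exists[OF F G', where E = ?E and g = "c\<^sup>2"])
      (rule gain, assumption, assumption, blast)
  have low: "stage_cost Q R K x \<le> x \<bullet> (P *v x)" for x
    using P(3)[of x] by (simp add: norm_performance_output[OF Q R])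
  have "0 < x \<bullet> (P *v x)" if "x \<noteq> 0" for x
  proof -
    have "0 < x \<bullet> (Q *v x)" using Q that by (simp add: pos_def_def)
    moreover have "0 \<le> (K *v x) \<bullet> (R *v (K *v x))"
      using pos_def_imp_pos_semidef[OF R] by (simp add: pos_semidef_def)
    ultimately show ?thesis using low[of x] by (simp add: stage_cost_def)
  qed
  then have "pos_def P" using P(1) by (simp add: pos_def_def)
  then show ?thesis using that P(2,4) low by (auto simp: certifies_iff_dissipates[OF Q R])
qed

section \<open>Convexity of the certificates\<close>

lemma pos_def_inverse:
  fixes P :: "real^'n^'n"
  assumes "pos_def P"
  obtains X where "pos_def X" "\<And>x. P *v (X *v x) = x" "\<And>x. X *v (P *v x) = x"
proof -
  have sym: "symmetric_mat P" and pos: "\<And>x. x \<noteq> 0 \<Longrightarrow> 0 < x \<bullet> (P *v x)"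
    using assms by (auto simp: pos_def_def)
  have "x = 0" if "P *v x = 0" for x using pos[of x] that by fastforce
  then obtain X where XP: "X ** P = mat 1" by (metis matrix_left_invertible_ker)
  then have PX: "P ** X = mat 1" by (simp add: matrix_left_right_inverse)
  have inv: "P *v (X *v x) = x" "X *v (P *v x) = x" for x
    by (simp_all add: matrix_vector_mul_assoc XP PX)
  have "symmetric_mat X"
    by (rule symmetric_matI) (metis inv symmetric_mat_inner[OF sym])
  moreover have "0 < x \<bullet> (X *v x)" if "x \<noteq> 0" for x
  proof -
    have "X *v x \<noteq> 0" using inv(1)[of x] that by auto
    from pos[OF this] show ?thesis by (simp add: inv inner_commute)
  qed
  ultimately have "pos_def X" by (simp add: pos_def_def)
  then show ?thesis using inv by (rule that)
qed

lemma psd_form_convex: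
  fixes M :: "real^'n^'n"
  assumes nonneg: "\<And>x. 0 \<le> x \<bullet> (M *v x)" and t: "0 \<le> t" "t \<le> 1"
  shows "((1 - t) *\<^sub>R a + t *\<^sub>R b) \<bullet> (M *v ((1 - t) *\<^sub>R a + t *\<^sub>R b))
    \<le> (1 - t) * (a \<bullet> (M *v a)) + t * (b \<bullet> (M *v b))"
proof -
  have "0 \<le> (1 - t) * t * ((a - b) \<bullet> (M *v (a - b)))" using nonneg t by simp
  also have "\<dots> = (1 - t) * (a \<bullet> (M *v a)) + t * (b \<bullet> (M *v b))
      - ((1 - t) *\<^sub>R a + t *\<^sub>R b) \<bullet> (M *v ((1 - t) *\<^sub>R a + t *\<^sub>R b))"
    by (simp add: matrix_vector_right_distrib matrix_vector_mult_diff_distrib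
        matrix_vector_mult_scaleR inner_add inner_diff algebra_simps)
  finally show ?thesis by simp
qed

text \<open>Completion of the square. Equality holds at \<open>z = P y\<close>, so the form of \<open>P\<close> is a supremum of
expressions that are affine in the inverse \<open>X\<close>.\<close>

lemma inverse_form_dual_le:
  fixes P X :: "real^'n^'n"
  assumes "pos_def P" and "\<And>x. P *v (X *v x) = x"
  shows "2 * (z \<bullet> y) - z \<bullet> (X *v z) \<le> y \<bullet> (P *v y)"
proof -
  have sym: "symmetric_mat P" using assms(1) by (simp add: pos_def_def)
  have "0 \<le> (y - X *v z) \<bullet> (P *v (y - X *v z))"
    using pos_def_imp_pos_semidef[OF assms(1)] by (simp add: pos_semidef_def)
  also have "\<dots> = y \<bullet> (P *v y) - 2 * (z \<bullet> y) + z \<bullet> (X *v z)"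
    using symmetric_mat_inner[OF sym, of "X *v z" y]
    by (simp add: matrix_vector_mult_diff_distrib inner_diff assms(2) inner_commute)
  finally show ?thesis by simp
qed

text \<open>Nonnegativity of the form at a gradient step \<open>x - P x / C\<close> bounds \<open>\<parallel>P x\<parallel>\<^sup>2\<close> by \<open>C (x \<bullet> P x)\<close>.\<close>

lemma norm_psd_apply_le:
  fixes P :: "real^'n^'n"
  assumes "pos_semidef P" and le: "\<And>x. x \<bullet> (P *v x) \<le> C * (norm x)\<^sup>2" and C: "0 < C"
  shows "norm (P *v x) \<le> C * norm x"
proof (rule power2_le_imp_le)
  have sym: "symmetric_mat P" using assms(1) by (simp add: pos_semidef_def)
  define s where "s = 1 / C"
  have "0 \<le> (x - s *\<^sub>R (P *v x)) \<bullet> (P *v (x - s *\<^sub>R (P *v x)))"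
    using assms(1) by (simp add: pos_semidef_def)
  also have "\<dots> = x \<bullet> (P *v x) - 2 * s * (norm (P *v x))\<^sup>2 + s\<^sup>2 * ((P *v x) \<bullet> (P *v (P *v x)))"
    using symmetric_mat_inner[OF sym, of x "P *v x"]
    by (simp add: matrix_vector_mult_diff_distrib matrix_vector_mult_scaleR inner_diff
        dot_square_norm power2_eq_square[of s] algebra_simps)
  also have "\<dots> \<le> C * (norm x)\<^sup>2 - 2 * s * (norm (P *v x))\<^sup>2 + s\<^sup>2 * (C * (norm (P *v x))\<^sup>2)"
    using le[of x] le[of "P *v x"] by (intro add_mono diff_mono mult_left_mono order_refl) auto
  also have "\<dots> = C * (norm x)\<^sup>2 - (norm (P *v x))\<^sup>2 / C"
    using C by (simp add: s_def field_simps power2_eq_square)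
  finally show "(norm (P *v x))\<^sup>2 \<le> (C * norm x)\<^sup>2"
    using C by (simp add: field_simps power2_eq_square)
qed (use C in simp)

lemma norm_matrix_le:
  fixes M :: "real^'n^'m"
  assumes le: "\<And>x. norm (M *v x) \<le> c * norm x"
  shows "norm M \<le> real (CARD('m) * CARD('n)) * c"
proof -
  have entry: "\<bar>M $ i $ j\<bar> \<le> c" for i j
  proof -
    have "\<bar>M $ i $ j\<bar> = \<bar>(M *v axis j 1) $ i\<bar>"
      by (simp add: matrix_vector_mult_basis column_def)
    also have "\<dots> \<le> norm (M *v axis j 1)" by (rule component_le_norm_cart)
    also have "\<dots> \<le> c" using le[of "axis j 1"] by simp
    finally show ?thesis .
  qed
  have "norm M \<le> (\<Sum>i\<in>UNIV. norm (M $ i))" by (simp add: norm_vec_def L2_set_le_sum)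
  also have "\<dots> \<le> (\<Sum>i\<in>(UNIV::'m set). \<Sum>j\<in>(UNIV::'n set). \<bar>M $ i $ j\<bar>)"
    by (intro sum_mono norm_le_l1_cart)
  also have "\<dots> \<le> (\<Sum>i\<in>(UNIV::'m set). \<Sum>j\<in>(UNIV::'n set). c)"
    by (intro sum_mono entry)
  finally show ?thesis by simp
qed

text \<open>In the variables \<open>X = P\<^sup>-\<^sup>1\<close> and \<open>Y = K X\<close> the certificates form a convex set, and here \<open>P\<close> is the
inverse of \<open>X = (1 - t) X1 + t X2\<close>. The value \<open>x \<bullet> P x\<close> is the least value of
\<open>(1 - t) (x1 \<bullet> P1 x1) + t (x2 \<bullet> P2 x2)\<close> over all splittings \<open>x = (1 - t) x1 + t x2\<close>, attained at
\<open>x1 = X1 P x\<close> and \<open>x2 = X2 P x\<close>. The optimal splitting serves for the current state, an arbitrary one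
suffices for the next state. The gain
\<open>Y X\<^sup>-\<^sup>1\<close> applies the mixture of \<open>K1 x1\<close> and \<open>K2 x2\<close>, so the two dissipation inequalities at \<open>x1\<close> and
\<open>x2\<close> with the same disturbance add up to the one at \<open>x\<close>. Since
\<open>Y = K1 X + t (K2 - K1) X2\<close>, the new gain has the form in the conclusion.\<close>

lemma certifies_interpolate:
  fixes A :: "real^'x^'x" and B :: "real^'u^'x" and G :: "real^'w^'x"
  assumes Q: "pos_def Q" and R: "pos_def R"
    and cert1: "certifies A B G Q R g1 K1 P1" and cert2: "certifies A B G Q R g2 K2 P2"
    and inv2: "pos_def X2" "\<And>x. P2 *v (X2 *v x) = x"
    and t: "0 \<le> t" "t \<le> 1"
  obtains P where
    "certifies A B G Q R ((1 - t) * g1 + t * g2) (K1 + t *\<^sub>R ((K2 - K1) ** X2 ** P)) P"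
    "\<And>x. x \<bullet> (P *v x) \<le> (1 - t) * (x \<bullet> (P1 *v x)) + t * (x \<bullet> (P2 *v x))"
proof -
  have P1: "pos_def P1" and P2: "pos_def P2" using cert1 cert2 by (auto simp: certifies_def)
  obtain X1 where inv1: "pos_def X1" "\<And>x. P1 *v (X1 *v x) = x" using pos_def_inverse[OF P1] by blast
  define X where "X = (1 - t) *\<^sub>R X1 + t *\<^sub>R X2"
  have Xv: "X *v z = (1 - t) *\<^sub>R (X1 *v z) + t *\<^sub>R (X2 *v z)" for z
    by (simp add: X_def matrix_vector_mult_add_rdistrib scaleR_matrix_vector_assoc)
  have "pos_def X"
    unfolding pos_def_def
  proof (intro conjI allI impI)
    show "symmetric_mat X"
      using inv1(1) inv2(1) by (intro symmetric_matI)
        (simp add: Xv inner_add pos_def_def symmetric_mat_inner)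
    fix x :: "real^'x" assume "x \<noteq> 0"
    then have "0 < x \<bullet> (X1 *v x)" "0 < x \<bullet> (X2 *v x)" using inv1(1) inv2(1) by (auto simp: pos_def_def)
    then show "0 < x \<bullet> (X *v x)"
      using t by (cases "t = 0") (auto simp: Xv inner_add intro!: add_nonneg_pos)
  qed
  then obtain P where P: "pos_def P" and XP: "\<And>x. X *v (P *v x) = x" using pos_def_inverse by metis
  define K where "K = K1 + t *\<^sub>R ((K2 - K1) ** X2 ** P)"
  have nonneg: "0 \<le> x \<bullet> (M *v x)" if "pos_def M" for M :: "real^'k^'k" and x
    using pos_def_imp_pos_semidef[OF that] by (simp add: pos_semidef_def)
  have split_le: "y \<bullet> (P *v y) \<le> (1 - t) * (y1 \<bullet> (P1 *v y1)) + t * (y2 \<bullet> (P2 *v y2))"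
    if y: "y = (1 - t) *\<^sub>R y1 + t *\<^sub>R y2" for y y1 y2
  proof -
    let ?z = "P *v y"
    have "y \<bullet> (P *v y) = 2 * (?z \<bullet> y) - ?z \<bullet> (X *v ?z)" by (simp add: XP inner_commute)
    also have "\<dots> = (1 - t) * (2 * (?z \<bullet> y1) - ?z \<bullet> (X1 *v ?z)) + t * (2 * (?z \<bullet> y2) - ?z \<bullet> (X2 *v ?z))"
      unfolding Xv by (subst (2) y) (simp add: inner_add algebra_simps)
    also have "\<dots> \<le> (1 - t) * (y1 \<bullet> (P1 *v y1)) + t * (y2 \<bullet> (P2 *v y2))"
      using t by (intro add_mono mult_left_mono inverse_form_dual_le P1 P2 inv1 inv2) auto
    finally show ?thesis .
  qed
  have "certifies A B G Q R ((1 - t) * g1 + t * g2) K P"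
    unfolding certifies_def
  proof (intro conjI allI)
    fix x w
    define z x1 x2 where "z = P *v x" and "x1 = X1 *v z" and "x2 = X2 *v z"
    have x: "x = (1 - t) *\<^sub>R x1 + t *\<^sub>R x2" using XP[of x] by (simp add: Xv z_def x1_def x2_def)
    have Kx: "K *v x = (1 - t) *\<^sub>R (K1 *v x1) + t *\<^sub>R (K2 *v x2)"
    proof -
      have "K *v x = K1 *v x + t *\<^sub>R (K2 *v x2 - K1 *v x2)"
        by (simp add: K_def x2_def z_def matrix_vector_mult_add_rdistrib matrix_vector_mult_diff_rdistrib
            flip: scaleR_matrix_vector_assoc matrix_vector_mul_assoc)
      also have "K1 *v x = (1 - t) *\<^sub>R (K1 *v x1) + t *\<^sub>R (K1 *v x2)"
        by (subst x) (simp add: matrix_vector_right_distrib matrix_vector_mult_scaleR)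
      finally show ?thesis by (simp add: algebra_simps)
    qed
    define y1 y2 where "y1 = A *v x1 + B *v (K1 *v x1) + G *v w" and "y2 = A *v x2 + B *v (K2 *v x2) + G *v w"
    have y: "A *v x + B *v (K *v x) + G *v w = (1 - t) *\<^sub>R y1 + t *\<^sub>R y2"
      unfolding Kx y1_def y2_def
      by (subst x) (simp add: matrix_vector_right_distrib matrix_vector_mult_scaleR
          matrix_vector_mult_diff_distrib algebra_simps)
    have "x \<bullet> (P *v x) = z \<bullet> (X *v z)" by (simp add: XP z_def inner_commute)
    also have "\<dots> = (1 - t) * (z \<bullet> (X1 *v z)) + t * (z \<bullet> (X2 *v z))"
      by (simp add: Xv inner_add_right)
    finally have Vx: "x \<bullet> (P *v x) = (1 - t) * (x1 \<bullet> (P1 *v x1)) + t * (x2 \<bullet> (P2 *v x2))"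
      by (simp add: x1_def x2_def inv1 inv2 inner_commute)
    have stage: "stage_cost Q R K x \<le> (1 - t) * stage_cost Q R K1 x1 + t * stage_cost Q R K2 x2"
    proof -
      have "x \<bullet> (Q *v x) \<le> (1 - t) * (x1 \<bullet> (Q *v x1)) + t * (x2 \<bullet> (Q *v x2))"
        unfolding x by (rule psd_form_convex[OF nonneg[OF Q] t])
      moreover have "(K *v x) \<bullet> (R *v (K *v x))
          \<le> (1 - t) * ((K1 *v x1) \<bullet> (R *v (K1 *v x1))) + t * ((K2 *v x2) \<bullet> (R *v (K2 *v x2)))"
        unfolding Kx by (rule psd_form_convex[OF nonneg[OF R] t])
      ultimately show ?thesis by (simp add: stage_cost_def distrib_left)
    qed
    let ?b1 = "stage_cost Q R K1 x1 - g1 * (norm w)\<^sup>2 + y1 \<bullet> (P1 *v y1)"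
    let ?b2 = "stage_cost Q R K2 x2 - g2 * (norm w)\<^sup>2 + y2 \<bullet> (P2 *v y2)"
    have b: "?b1 \<le> x1 \<bullet> (P1 *v x1)" "?b2 \<le> x2 \<bullet> (P2 *v x2)"
      using cert1 cert2 by (auto simp: certifies_def y1_def y2_def)
    let ?y = "A *v x + B *v (K *v x) + G *v w"
    have "stage_cost Q R K x - ((1 - t) * g1 + t * g2) * (norm w)\<^sup>2 + ?y \<bullet> (P *v ?y)
        \<le> (1 - t) * ?b1 + t * ?b2"
      using stage split_le[OF y] by (simp add: algebra_simps)
    also have "\<dots> \<le> x \<bullet> (P *v x)"
      unfolding Vx using t b by (intro add_mono mult_left_mono) auto
    finally show "stage_cost Q R K x - ((1 - t) * g1 + t * g2) * (norm w)\<^sup>2 + ?y \<bullet> (P *v ?y)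
        \<le> x \<bullet> (P *v x)" .
  qed (rule P)
  moreover have "x \<bullet> (P *v x) \<le> (1 - t) * (x \<bullet> (P1 *v x)) + t * (x \<bullet> (P2 *v x))" for x
    by (rule split_le) (simp flip: scaleR_add_left)
  ultimately show ?thesis using that unfolding K_def by blast
qed

text \<open>The certificate dominates \<open>u \<bullet> R u\<close> for \<open>u = K x\<close>; this bounds the gains in a sublevel set.\<close>

lemma certified_gain_bound:
  assumes "pos_semidef Q" and r: "0 < r" "\<And>u. r * (norm u)\<^sup>2 \<le> u \<bullet> (R *v u)"
    and low: "\<And>x. stage_cost Q R K x \<le> x \<bullet> (P *v x)" and up: "\<And>x. x \<bullet> (P *v x) \<le> C * (norm x)\<^sup>2"
    and C: "0 < C"
  shows "norm (K *v x) \<le> sqrt (C / r) * norm x"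
proof (rule power2_le_imp_le)
  have "r * (norm (K *v x))\<^sup>2 \<le> stage_cost Q R K x"
    using r(2)[of "K *v x"] assms(1) by (simp add: stage_cost_def pos_semidef_def add_increasing)
  also have "\<dots> \<le> C * (norm x)\<^sup>2" using low up order_trans by blast
  finally show "(norm (K *v x))\<^sup>2 \<le> (sqrt (C / r) * norm x)\<^sup>2"
    using r C by (simp add: power_mult_distrib field_simps)
qed (use r C in simp)

section \<open>Minimum and gradient dominance\<close>

lemma full_row_rank_right_inverse:
  fixes G :: "real^'w^'x"
  assumes "full_row_rank G"
  obtains G' where "G ** G' = mat 1"
  using assms full_rank_surjective[of G] matrix_right_invertible_surjective[of G]
  unfolding full_row_rank_def by blast

lemma tendsto_matrix_vector_mult [tendsto_intros]:
  fixes M :: "'a \<Rightarrow> real^'n^'m"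
  assumes "(M \<longlongrightarrow> M0) H" "(x \<longlongrightarrow> x0) H"
  shows "((\<lambda>k. M k *v x k) \<longlongrightarrow> M0 *v x0) H"
  unfolding matrix_vector_mult_def by (intro tendsto_intros assms)

text \<open>Gains whose costs approach the infimum, together with their certificates, stay bounded. A limit of
the certificates is positive definite because it still dominates \<open>Q\<close>, and it satisfies the
dissipation inequality at the infimum; it certifies that the limit gain is stabilizing and optimal.\<close>

lemma hinf_cost_attains_min:
  fixes A :: "real^'x^'x" and B :: "real^'u^'x" and G :: "real^'w^'x"
  assumes Q: "pos_def Q" and R: "pos_def R" and rank: "full_row_rank G"
    and ne: "stabilizing_gains A B (mat 1) \<noteq> {}"
  obtains K where "K \<in> stabilizing_gains A B (mat 1)"
    "hinf_cost A B G (mat 1) Q R K = hinf_opt A B G (mat 1) Q R"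
proof -
  let ?S = "stabilizing_gains A B (mat 1)"
  let ?J = "hinf_cost A B G (mat 1) Q R"
  define m where "m = hinf_opt A B G (mat 1) Q R"
  have bdd: "bdd_below (?J ` ?S)" using hinf_cost_nonneg by (intro bdd_belowI2[of _ 0])
  have m_le: "m \<le> ?J K" if "K \<in> ?S" for K
    unfolding m_def hinf_opt_def by (rule cINF_lower[OF bdd that])
  have m0: "0 \<le> m"
    unfolding m_def hinf_opt_def by (intro cINF_greatest ne hinf_cost_nonneg)
  obtain G' where G': "G ** G' = mat 1" using full_row_rank_right_inverse[OF rank] .
  obtain e where e: "e > 0" "\<And>x. norm (G' *v x) \<le> e * norm x"
    using linear_bounded_pos[OF matrix_vector_mul_linear[of G']] by blast
  obtain r where r: "r > 0" "\<And>u. r * (norm u)\<^sup>2 \<le> u \<bullet> (R *v u)" using pos_def_coercive[OF R] by blast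
  define c where "c n = m + 1 / real (Suc n)" for n
  have c: "0 < c n" "c n \<le> m + 1" for n
    unfolding c_def using m0 by (auto intro: add_nonneg_pos)
  have "\<exists>K P. certifies A B G Q R ((c n)\<^sup>2) K P \<and> (\<forall>x. stage_cost Q R K x \<le> x \<bullet> (P *v x))
      \<and> (\<forall>x. x \<bullet> (P *v x) \<le> (c n)\<^sup>2 * (norm (G' *v x))\<^sup>2)" for n
  proof -
    have "m < c n" by (simp add: c_def)
    then obtain K where "K \<in> ?S" "?J K < c n"
      unfolding m_def hinf_opt_def using cINF_less_iff[OF ne bdd] by blast
    then show ?thesis using cost_bound_imp_certificate[OF Q R G', of K A B "c n"] by (metis less_imp_le)
  qed
  then obtain K P where cert: "\<And>n. certifies A B G Q R ((c n)\<^sup>2) (K n) (P n)"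
    and low: "\<And>n x. stage_cost Q R (K n) x \<le> x \<bullet> (P n *v x)"
    and up: "\<And>n x. x \<bullet> (P n *v x) \<le> (c n)\<^sup>2 * (norm (G' *v x))\<^sup>2"
    by metis
  \<comment> \<open>The levels \<open>c n\<close> are at most \<open>m + 1\<close>, so \<open>C\<close> bounds all certificates.\<close>
  define C where "C = (m + 1)\<^sup>2 * e\<^sup>2"
  have C: "0 < C" using m0 e(1) by (simp add: C_def)
  have upC: "x \<bullet> (P n *v x) \<le> C * (norm x)\<^sup>2" for n x
  proof -
    have "(c n)\<^sup>2 * (norm (G' *v x))\<^sup>2 \<le> (m + 1)\<^sup>2 * (e * norm x)\<^sup>2"
      using c[of n] e by (intro mult_mono power_mono) (auto simp: less_imp_le)
    then show ?thesis using up[of x n] by (simp add: C_def power_mult_distrib mult.assoc)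
  qed
  have Pn: "pos_def (P n)" for n using cert by (simp add: certifies_def)
  have nP: "norm (P n) \<le> real (CARD('x) * CARD('x)) * C" for n
    by (intro norm_matrix_le norm_psd_apply_le upC C pos_def_imp_pos_semidef Pn)
  have nK: "norm (K n) \<le> real (CARD('u) * CARD('x)) * sqrt (C / r)" for n
    by (intro norm_matrix_le certified_gain_bound[OF pos_def_imp_pos_semidef[OF Q] r low upC C])
  have "bounded (range (\<lambda>n. (K n, P n)))"
  proof (rule boundedI)
    fix y assume "y \<in> range (\<lambda>n. (K n, P n))"
    then obtain n where "y = (K n, P n)" by blast
    then show "norm y \<le> real (CARD('u) * CARD('x)) * sqrt (C / r) + real (CARD('x) * CARD('x)) * C"
      using norm_Pair_le[of "K n" "P n"] nK[of n] nP[of n] by simp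
  qed
  then obtain l h where h: "strict_mono h" and lim: "((\<lambda>n. (K n, P n)) \<circ> h) \<longlonglongrightarrow> l"
    using bounded_imp_convergent_subsequence by blast
  define K0 P0 where "K0 = fst l" and "P0 = snd l"
  have limK: "(\<lambda>n. K (h n)) \<longlonglongrightarrow> K0" using tendsto_fst[OF lim] by (simp add: K0_def o_def)
  have limP: "(\<lambda>n. P (h n)) \<longlonglongrightarrow> P0" using tendsto_snd[OF lim] by (simp add: P0_def o_def)
  have "c \<longlonglongrightarrow> m + 0"
    unfolding c_def using LIMSEQ_inverse_real_of_nat
    by (intro tendsto_add tendsto_const) (simp add: inverse_eq_divide)
  then have limc: "(\<lambda>n. c (h n)) \<longlonglongrightarrow> m"
    using LIMSEQ_subseq_LIMSEQ[OF _ h] by (fastforce simp: o_def)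
  have "certifies A B G Q R (m\<^sup>2) K0 P0"
    unfolding certifies_def
  proof (intro conjI allI)
    have "symmetric_mat P0"
    proof (rule symmetric_matI)
      fix x y
      have "(P (h n) *v x) \<bullet> y = x \<bullet> (P (h n) *v y)" for n
        using Pn[of "h n"] by (simp add: pos_def_def symmetric_mat_inner)
      moreover have "(\<lambda>n. (P (h n) *v x) \<bullet> y) \<longlonglongrightarrow> (P0 *v x) \<bullet> y"
        by (intro tendsto_intros limP)
      moreover have "(\<lambda>n. x \<bullet> (P (h n) *v y)) \<longlonglongrightarrow> x \<bullet> (P0 *v y)"
        by (intro tendsto_intros limP)
      ultimately show "(P0 *v x) \<bullet> y = x \<bullet> (P0 *v y)" using LIMSEQ_unique by simp
    qed
    moreover have "0 < x \<bullet> (P0 *v x)" if "x \<noteq> 0" for x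
    proof -
      have "(\<lambda>n. x \<bullet> (P (h n) *v x)) \<longlonglongrightarrow> x \<bullet> (P0 *v x)"
        by (intro tendsto_intros limP)
      moreover have "x \<bullet> (Q *v x) \<le> x \<bullet> (P (h n) *v x)" for n
      proof -
        have "0 \<le> (K (h n) *v x) \<bullet> (R *v (K (h n) *v x))"
          using pos_def_imp_pos_semidef[OF R] by (simp add: pos_semidef_def)
        then show ?thesis using low[of "h n" x] by (simp add: stage_cost_def)
      qed
      ultimately have "x \<bullet> (Q *v x) \<le> x \<bullet> (P0 *v x)" by (intro LIMSEQ_le_const) auto
      moreover have "0 < x \<bullet> (Q *v x)" using Q that by (simp add: pos_def_def)
      ultimately show ?thesis by simp
    qed
    ultimately show "pos_def P0" by (simp add: pos_def_def)
    fix x w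
    have "stage_cost Q R (K (h n)) x - (c (h n))\<^sup>2 * (norm w)\<^sup>2
        + (A *v x + B *v (K (h n) *v x) + G *v w) \<bullet> (P (h n) *v (A *v x + B *v (K (h n) *v x) + G *v w))
        \<le> x \<bullet> (P (h n) *v x)" for n
      using cert[of "h n"] by (simp add: certifies_def)
    moreover have "(\<lambda>n. stage_cost Q R (K (h n)) x - (c (h n))\<^sup>2 * (norm w)\<^sup>2
        + (A *v x + B *v (K (h n) *v x) + G *v w) \<bullet> (P (h n) *v (A *v x + B *v (K (h n) *v x) + G *v w)))
        \<longlonglongrightarrow> stage_cost Q R K0 x - m\<^sup>2 * (norm w)\<^sup>2
        + (A *v x + B *v (K0 *v x) + G *v w) \<bullet> (P0 *v (A *v x + B *v (K0 *v x) + G *v w))"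
      unfolding stage_cost_def by (intro tendsto_intros limP limK limc)
    moreover have "(\<lambda>n. x \<bullet> (P (h n) *v x)) \<longlonglongrightarrow> x \<bullet> (P0 *v x)"
      by (intro tendsto_intros limP)
    ultimately show "stage_cost Q R K0 x - m\<^sup>2 * (norm w)\<^sup>2
        + (A *v x + B *v (K0 *v x) + G *v w) \<bullet> (P0 *v (A *v x + B *v (K0 *v x) + G *v w))
        \<le> x \<bullet> (P0 *v x)"
      by (intro LIMSEQ_le) auto
  qed
  from certificate_imp_cost_bound[OF Q R m0 this] m_le that
  show ?thesis unfolding m_def[symmetric] by (meson antisym)
qed

text \<open>The curve is the interpolation of certificates from \<open>K\<close> to the fixed gain \<open>K2\<close>. The distance
\<open>\<parallel>K' - K\<parallel>\<close> is at most \<open>t\<close> times the norm of \<open>(K2 - K) X2 P\<close>, and each of the three factors is bounded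
on the sublevel set.\<close>

lemma descent_curve:
  fixes A :: "real^'x^'x" and B :: "real^'u^'x" and G :: "real^'w^'x"
  assumes Q: "pos_def Q" and R: "pos_def R" and rank: "full_row_rank G"
    and K2: "K2 \<in> stabilizing_gains A B (mat 1)" and le\<nu>: "hinf_cost A B G (mat 1) Q R K2 \<le> \<nu>"
  shows "\<exists>M>0. \<forall>K\<in>hinf_sublevel A B G (mat 1) Q R \<nu>. \<forall>t\<in>{0..1}. \<exists>K'\<in>stabilizing_gains A B (mat 1).
    norm (K' - K) \<le> t * M \<and>
    (hinf_cost A B G (mat 1) Q R K')\<^sup>2
      \<le> (1 - t) * (hinf_cost A B G (mat 1) Q R K)\<^sup>2 + t * (hinf_cost A B G (mat 1) Q R K2)\<^sup>2"
proof -
  let ?S = "stabilizing_gains A B (mat 1)"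
  let ?J = "hinf_cost A B G (mat 1) Q R"
  have \<nu>: "0 \<le> \<nu>" using hinf_cost_nonneg[OF K2, of G Q R] le\<nu> by simp
  obtain G' where G': "G ** G' = mat 1" using full_row_rank_right_inverse[OF rank] .
  obtain e where e: "e > 0" "\<And>x. norm (G' *v x) \<le> e * norm x"
    using linear_bounded_pos[OF matrix_vector_mul_linear[of G']] by blast
  obtain r where r: "r > 0" "\<And>u. r * (norm u)\<^sup>2 \<le> u \<bullet> (R *v u)" using pos_def_coercive[OF R] by blast
  \<comment> \<open>\<open>\<nu> + 1\<close> instead of \<open>\<nu>\<close> keeps \<open>C\<close> positive when \<open>\<nu> = 0\<close>.\<close>
  define C where "C = (\<nu> + 1)\<^sup>2 * e\<^sup>2"
  have C: "0 < C" using \<nu> e(1) by (simp add: C_def)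
  have cert: "\<exists>P. certifies A B G Q R ((?J K)\<^sup>2) K P \<and> (\<forall>x. stage_cost Q R K x \<le> x \<bullet> (P *v x))
      \<and> (\<forall>x. x \<bullet> (P *v x) \<le> C * (norm x)\<^sup>2)" if K: "K \<in> ?S" and "?J K \<le> \<nu>" for K
  proof -
    obtain P where P: "certifies A B G Q R ((?J K)\<^sup>2) K P" "\<And>x. stage_cost Q R K x \<le> x \<bullet> (P *v x)"
      "\<And>x. x \<bullet> (P *v x) \<le> (?J K)\<^sup>2 * (norm (G' *v x))\<^sup>2"
      using cost_bound_imp_certificate[OF Q R G' K order_refl] by blast
    have "x \<bullet> (P *v x) \<le> C * (norm x)\<^sup>2" for x
    proof -
      have "(?J K)\<^sup>2 * (norm (G' *v x))\<^sup>2 \<le> (\<nu> + 1)\<^sup>2 * (e * norm x)\<^sup>2"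
        using \<open>?J K \<le> \<nu>\<close> hinf_cost_nonneg[OF K, of G Q R] e by (intro mult_mono power_mono) auto
      then show ?thesis using P(3)[of x] by (simp add: C_def power_mult_distrib mult.assoc)
    qed
    then show ?thesis using P by blast
  qed
  obtain P2 where P2: "certifies A B G Q R ((?J K2)\<^sup>2) K2 P2" "\<And>x. stage_cost Q R K2 x \<le> x \<bullet> (P2 *v x)"
      "\<And>x. x \<bullet> (P2 *v x) \<le> C * (norm x)\<^sup>2"
    using cert[OF K2 le\<nu>] by blast
  have "pos_def P2" using P2(1) by (simp add: certifies_def)
  then obtain X2 where X2: "pos_def X2" "\<And>x. P2 *v (X2 *v x) = x" using pos_def_inverse by blast
  obtain s where s: "s > 0" "\<And>x. norm (X2 *v x) \<le> s * norm x"
    using linear_bounded_pos[OF matrix_vector_mul_linear[of X2]] by blast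
  define k where "k = sqrt (C / r)"
  have k: "0 < k" using C r by (simp add: k_def)
  \<comment> \<open>\<open>2 k\<close>, \<open>s\<close> and \<open>C\<close> bound \<open>K2 - K\<close>, \<open>X2\<close> and \<open>P\<close> as operators; the cardinalities pass to the
    Frobenius norm.\<close>
  define M where "M = real (CARD('u) * CARD('x)) * (2 * k * s * C)"
  have M: "0 < M" using k s C by (simp add: M_def)
  have "\<exists>K'\<in>?S. norm (K' - K) \<le> t * M \<and> (?J K')\<^sup>2 \<le> (1 - t) * (?J K)\<^sup>2 + t * (?J K2)\<^sup>2"
    if K: "K \<in> ?S" "?J K \<le> \<nu>" and t: "0 \<le> t" "t \<le> 1" for K t
  proof -
    obtain P1 where P1: "certifies A B G Q R ((?J K)\<^sup>2) K P1" "\<And>x. stage_cost Q R K x \<le> x \<bullet> (P1 *v x)"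
      "\<And>x. x \<bullet> (P1 *v x) \<le> C * (norm x)\<^sup>2"
      using cert[OF K] by blast
    define g where "g = (1 - t) * (?J K)\<^sup>2 + t * (?J K2)\<^sup>2"
    have g: "0 \<le> g" using t by (simp add: g_def)
    obtain P where P: "certifies A B G Q R g (K + t *\<^sub>R ((K2 - K) ** X2 ** P)) P"
      "\<And>x. x \<bullet> (P *v x) \<le> (1 - t) * (x \<bullet> (P1 *v x)) + t * (x \<bullet> (P2 *v x))"
      using certifies_interpolate[OF Q R P1(1) P2(1) X2 t] unfolding g_def by blast
    define K' where "K' = K + t *\<^sub>R ((K2 - K) ** X2 ** P)"
    have "certifies A B G Q R ((sqrt g)\<^sup>2) K' P" using P(1) g by (simp add: K'_def)
    from certificate_imp_cost_bound[OF Q R _ this] g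
    have K': "K' \<in> ?S" "?J K' \<le> sqrt g" by auto
    have "(?J K')\<^sup>2 \<le> (sqrt g)\<^sup>2" using K'(2) hinf_cost_nonneg[OF K'(1)] by (rule power_mono)
    then have cost: "(?J K')\<^sup>2 \<le> g" using g by simp
    have upP: "x \<bullet> (P *v x) \<le> C * (norm x)\<^sup>2" for x
    proof -
      have "x \<bullet> (P *v x) \<le> (1 - t) * (C * (norm x)\<^sup>2) + t * (C * (norm x)\<^sup>2)"
        using P(2)[of x] P1(3)[of x] P2(3)[of x] t
        by (meson add_mono mult_left_mono diff_ge_0_iff_ge order_trans)
      then show ?thesis by (simp add: algebra_simps)
    qed
    have "pos_semidef P" using P(1) by (simp add: certifies_def pos_def_imp_pos_semidef)
    note Pv = norm_psd_apply_le[OF this upP C]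
    note Kv = certified_gain_bound[OF pos_def_imp_pos_semidef[OF Q] r P1(2,3) C, folded k_def]
    note K2v = certified_gain_bound[OF pos_def_imp_pos_semidef[OF Q] r P2(2,3) C, folded k_def]
    have "norm (((K2 - K) ** X2 ** P) *v x) \<le> 2 * k * s * C * norm x" for x
    proof -
      let ?y = "X2 *v (P *v x)"
      have "norm (((K2 - K) ** X2 ** P) *v x) = norm (K2 *v ?y - K *v ?y)"
        by (simp add: matrix_vector_mult_diff_rdistrib flip: matrix_vector_mul_assoc)
      also have "\<dots> \<le> 2 * k * norm ?y"
        using norm_triangle_ineq4[of "K2 *v ?y" "K *v ?y"] Kv[of ?y] K2v[of ?y] by simp
      also have "norm ?y \<le> s * (C * norm x)"
        using s(2)[of "P *v x"] Pv[of x] s(1) by (meson mult_left_mono less_imp_le order_trans)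
      finally show ?thesis using k by (simp add: mult_ac)
    qed
    from norm_matrix_le[OF this] have "norm ((K2 - K) ** X2 ** P) \<le> M" by (simp add: M_def)
    then have "norm (K' - K) \<le> t * M" using t by (simp add: K'_def mult_left_mono)
    then show ?thesis using K'(1) cost unfolding g_def by blast
  qed
  then show ?thesis using M by (intro exI[of _ M]) (auto simp: hinf_sublevel_def)
qed

text \<open>Moving a distance of at most \<open>t M\<close> lowers \<open>f\<close> by at least \<open>t d\<close>, whereas a subgradient \<open>v\<close> allows a
decrease of about \<open>\<parallel>v\<parallel> t M\<close> only.\<close>

lemma frechet_subgradient_ge_descent_rate:
  fixes f :: "'a::real_inner \<Rightarrow> real"
  assumes v: "v \<in> frechet_subdifferential S f x" and M: "0 < M"
    and descent: "\<And>t. 0 < t \<Longrightarrow> t \<le> 1 \<Longrightarrow> \<exists>y\<in>S. norm (y - x) \<le> t * M \<and> f y \<le> f x - t * d"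
  shows "d / M \<le> norm v"
proof (rule field_le_epsilon)
  fix e :: real assume e: "0 < e"
  have "0 \<le> Liminf (at x within S) (\<lambda>y. ereal ((f y - f x - v \<bullet> (y - x)) / norm (y - x)))"
    using v by (simp add: frechet_subdifferential_def)
  moreover have "ereal (- e) < 0" using e by simp
  ultimately have "eventually (\<lambda>y. ereal (- e) < ereal ((f y - f x - v \<bullet> (y - x)) / norm (y - x))) (at x within S)"
    unfolding le_Liminf_iff by blast
  then obtain s where s: "s > 0" and near: "\<And>y. y \<in> S \<Longrightarrow> y \<noteq> x \<Longrightarrow> dist y x < s \<Longrightarrow>
      - e < (f y - f x - v \<bullet> (y - x)) / norm (y - x)"
    unfolding eventually_at by auto
  define t where "t = min 1 (s / (2 * M))"
  have t: "0 < t" "t \<le> 1" using s M by (auto simp: t_def)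
  have "t * M \<le> s / (2 * M) * M" using M by (intro mult_right_mono) (auto simp: t_def)
  then have tM: "t * M < s" using s M by simp
  obtain y where y: "y \<in> S" "norm (y - x) \<le> t * M" "f y \<le> f x - t * d" using descent[OF t] by blast
  have "- ((norm v + e) * norm (y - x)) \<le> f y - f x"
  proof (cases "y = x")
    case False
    then have "- e * norm (y - x) < f y - f x - v \<bullet> (y - x)"
      using near[OF y(1) False] y(2) tM by (simp add: dist_norm pos_less_divide_eq)
    moreover have "- (norm v * norm (y - x)) \<le> v \<bullet> (y - x)"
      using Cauchy_Schwarz_ineq2[of v "y - x"] by linarith
    ultimately show ?thesis by (simp add: algebra_simps)
  qed simp
  moreover have "(norm v + e) * norm (y - x) \<le> (norm v + e) * (t * M)"
    using y(2) e by (intro mult_left_mono) (auto intro: add_nonneg_nonneg)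
  ultimately have "t * d \<le> t * ((norm v + e) * M)" using y(3) by (simp add: mult_ac)
  then have "d \<le> (norm v + e) * M" using t by simp
  then show "d / M \<le> norm v + e" using M by (simp add: divide_le_eq)
qed

theorem theorem2:
  fixes A :: "real^'x^'x" and B :: "real^'u^'x" and Bw :: "real^'w^'x"
    and C :: "real^'x^'x" and Q :: "real^'x^'x" and R :: "real^'u^'u"
  assumes "stabilizable A B"
    and "full_row_rank Bw" and "full_row_rank C"
    and "pos_def Q" and "pos_def R"
    and "stabilizing_gains A B C \<noteq> {}"
    and "C = mat 1"
  shows "(\<exists>K\<in>stabilizing_gains A B C. hinf_cost A B Bw C Q R K = hinf_opt A B Bw C Q R) \<and>
    (\<forall>\<nu>>hinf_opt A B Bw C Q R. \<exists>\<mu>>0. \<forall>K\<in>hinf_sublevel A B Bw C Q R \<nu>.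
      ereal (\<mu> * (hinf_cost A B Bw C Q R K - hinf_opt A B Bw C Q R))
        \<le> edist_set 0 (frechet_subdifferential (stabilizing_gains A B C) (hinf_cost A B Bw C Q R) K))"
proof -
  note C = \<open>C = mat 1\<close>
  let ?S = "stabilizing_gains A B C" and ?J = "hinf_cost A B Bw C Q R"
  let ?m = "hinf_opt A B Bw C Q R"
  obtain K2 where K2: "K2 \<in> ?S" "?J K2 = ?m"
    using hinf_cost_attains_min[OF assms(4,5,2)] assms(6) unfolding C by blast
  have m0: "0 \<le> ?m" using hinf_cost_nonneg[OF K2(1)[unfolded C], of Bw Q R] K2(2) unfolding C by simp
  have "\<exists>\<mu>>0. \<forall>K\<in>hinf_sublevel A B Bw C Q R \<nu>.
      ereal (\<mu> * (?J K - ?m)) \<le> edist_set 0 (frechet_subdifferential ?S ?J K)" if \<nu>: "?m < \<nu>" for \<nu>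
  proof -
    have "?J K2 \<le> \<nu>" using K2(2) \<nu> by simp
    then obtain M where M: "0 < M" and curve: "\<And>K t. K \<in> hinf_sublevel A B Bw C Q R \<nu> \<Longrightarrow> t \<in> {0..1} \<Longrightarrow>
        \<exists>K'\<in>?S. norm (K' - K) \<le> t * M \<and> (?J K')\<^sup>2 \<le> (1 - t) * (?J K)\<^sup>2 + t * (?J K2)\<^sup>2"
      using descent_curve[OF assms(4,5,2) K2(1)[unfolded C]] unfolding C by metis
    have "1 / (2 * M) * (?J K - ?m) \<le> norm v"
      if K: "K \<in> hinf_sublevel A B Bw C Q R \<nu>" and v: "v \<in> frechet_subdifferential ?S ?J K" for K v
    proof -
      have "?m \<le> ?J K"
        unfolding hinf_opt_def using K hinf_cost_nonneg[of _ A B Bw Q R]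
        by (intro cINF_lower bdd_belowI2[of _ 0]) (auto simp: hinf_sublevel_def C)
      have "\<exists>K'\<in>?S. norm (K' - K) \<le> t * M \<and> ?J K' \<le> ?J K - t * ((?J K - ?m) / 2)"
        if t: "0 < t" "t \<le> 1" for t
      proof -
        obtain K' where K': "K' \<in> ?S" "norm (K' - K) \<le> t * M"
          "(?J K')\<^sup>2 \<le> (1 - t) * (?J K)\<^sup>2 + t * ?m\<^sup>2"
          using curve[OF K, of t] t unfolding K2(2) by auto
        have "?J K' \<le> ?J K - t * ((?J K - ?m) / 2)"
        proof (rule power2_le_imp_le)
          let ?d = "?J K - ?m"
          \<comment> \<open>The squared cost is convex along the curve; taking roots costs the factor 2.\<close>
          have "(1 - t) * (?J K)\<^sup>2 + t * ?m\<^sup>2 = (?J K - t * (?d / 2))\<^sup>2 - t * ?d * ?m - t\<^sup>2 * ?d\<^sup>2 / 4"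
            by (simp add: power2_eq_square field_simps)
          also have "\<dots> \<le> (?J K - t * (?d / 2))\<^sup>2"
          proof -
            have "0 \<le> t * ?d * ?m" using t m0 \<open>?m \<le> ?J K\<close> by simp
            moreover have "0 \<le> t\<^sup>2 * ?d\<^sup>2 / 4" by simp
            ultimately show ?thesis by linarith
          qed
          finally show "(?J K')\<^sup>2 \<le> (?J K - t * (?d / 2))\<^sup>2" using K'(3) by linarith
          have "t * (?d / 2) \<le> 1 * (?d / 2)" using t \<open>?m \<le> ?J K\<close> by (intro mult_right_mono) auto
          then show "0 \<le> ?J K - t * (?d / 2)" using m0 \<open>?m \<le> ?J K\<close> by simp
        qed
        then show ?thesis using K' by blast
      qed
      from frechet_subgradient_ge_descent_rate[OF v M this] show ?thesis by (simp add: field_simps)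
    qed
    then have "ereal (1 / (2 * M) * (?J K - ?m)) \<le> edist_set 0 (frechet_subdifferential ?S ?J K)"
      if "K \<in> hinf_sublevel A B Bw C Q R \<nu>" for K
      using that unfolding edist_set_def by (intro INF_greatest) (simp only: dist_0_norm ereal_less_eq)
    then show ?thesis using M by (intro exI[of _ "1 / (2 * M)"]) simp
  qed
  then show ?thesis using K2 by blast
qed

end
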